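(* Let $\Sigma=(\Gamma,\sigma)$ be a finite signed graph without loops (multiple edges allowed). Each of the following conditions is necessary and sufficient for $\Sigma$ to be line consistent: (i) $\Sigma$ is balanced, each vertex $v$ of degree $d(v)>3$ is totally positive, and each vertex of degree $d(v)=3$ is totally positive or has exactly one positive edge, which is an isthmus. (ii) $\Sigma$ is balanced, its negative subgraph $\Sigma^-$ is a vertex-disjoint union of paths and circles, and each endpoint $v$ of a negative edge is incident with at most one positive edge, which is an isthmus if $d_{\Sigma^-}(v)=2$. (iii) Each vertex $v$ of degree $d(v)>3$ is totally positive, each vertex of degree $d(v)=3$ is totally positive or has exactly one positive edge, and after deleting all positive isthmi, the resulting signed graph is balanced and the endpoints of every negative edge have degree at most $2$ (in that resulting graph). That is, $\Sigma$ is line consistent $\iff$ (i) $\iff$ (ii) $\iff$ (iii).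
   Context: A signed graph $\Sigma=(\Gamma,\sigma)$ is a graph $\Gamma$ (multiple edges allowed, no loops) with an edge signature $\sigma:E(\Gamma)\to\{+,-\}$. A circle is a cycle (a connected 2-regular subgraph; in a multigraph two parallel edges form a circle of length 2). The sign of a circle is the product of its edge signs; $\Sigma$ is balanced if every circle is positive. The degree $d(v)$ is the number of edges incident with $v$. A vertex is totally positive if all its incident edges are positive. The negative subgraph $\Sigma^-$ is the spanning subgraph whose edges are the negative edges, and $d_{\Sigma^-}(v)$ is the degree of $v$ in it. An isthmus is an edge belonging to no circle. The line graph $L(\Gamma)$ has the edges of $\Gamma$ as vertices, two such vertices being joined by one edge for each common endpoint (so parallel edges $e,e'$ of $\Gamma$ give a double edge in $L(\Gamma)$). The line graph of $\Sigma$ is the vertex-signed graph $(L(\Gamma),\sigma)$, where each vertex $e$ of $L(\Gamma)$ receives the sign $\sigma(e)$. A vertex-signed graph is consistent if every circle has positive product of its vertex signs. $\Sigma$ is line consistent if $(L(\Gamma),\sigma)$ is consistent. *)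

theory Defs
  imports Main
begin

text \<open>Undirected multigraphs. Edges are named objects, so distinct edges may have the same
  pair of endpoints.\<close>

record ('v, 'e) mgraph =
  verts :: "'v set"
  edges :: "'e set"
  ends :: "'e \<Rightarrow> 'v set"

locale finite_loopless_multigraph =
  fixes \<Gamma> :: "('v, 'e) mgraph"
  assumes finite_verts: "finite (verts \<Gamma>)"
    and finite_edges: "finite (edges \<Gamma>)"
    and ends_in_verts: "e \<in> edges \<Gamma> \<Longrightarrow> ends \<Gamma> e \<subseteq> verts \<Gamma>"
    and card_ends: "e \<in> edges \<Gamma> \<Longrightarrow> card (ends \<Gamma> e) = 2"

locale finite_signed_graph = finite_loopless_multigraph \<Gamma>
  for \<Gamma> :: "('v, 'e) mgraph" +
  fixes \<sigma> :: "'e \<Rightarrow> int"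
  assumes sign_values: "e \<in> edges \<Gamma> \<Longrightarrow> \<sigma> e = 1 \<or> \<sigma> e = -1"

definition incident_edges :: "('v, 'e) mgraph \<Rightarrow> 'v \<Rightarrow> 'e set" where
  "incident_edges G v = {e \<in> edges G. v \<in> ends G e}"

definition degree :: "('v, 'e) mgraph \<Rightarrow> 'v \<Rightarrow> nat" where
  "degree G v = card (incident_edges G v)"

definition adjacency :: "('v, 'e) mgraph \<Rightarrow> ('v \<times> 'v) set" where
  "adjacency G = {(u, v). \<exists>e \<in> edges G. ends G e = {u, v}}"

definition connected_graph :: "('v, 'e) mgraph \<Rightarrow> bool" where
  "connected_graph G \<longleftrightarrow> verts G \<noteq> {} \<and> (\<forall>u \<in> verts G. \<forall>v \<in> verts G. (u, v) \<in> (adjacency G)\<^sup>*)"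

text \<open>The endpoint maps are required to agree everywhere, not just on the edges of \<open>H\<close>, so that
  a subgraph is determined by its vertices and edges.\<close>

definition subgraph :: "('v, 'e) mgraph \<Rightarrow> ('v, 'e) mgraph \<Rightarrow> bool" where
  "subgraph H G \<longleftrightarrow> verts H \<subseteq> verts G \<and> edges H \<subseteq> edges G \<and> ends H = ends G
     \<and> (\<forall>e \<in> edges H. ends H e \<subseteq> verts H)"

definition circle_graph :: "('v, 'e) mgraph \<Rightarrow> bool" where
  "circle_graph C \<longleftrightarrow> connected_graph C \<and> (\<forall>v \<in> verts C. degree C v = 2)"

definition circle_of :: "('v, 'e) mgraph \<Rightarrow> ('v, 'e) mgraph \<Rightarrow> bool" where
  "circle_of C G \<longleftrightarrow> subgraph C G \<and> circle_graph C"

text \<open>A single vertex (\<open>vs\<close> of length 1, \<open>es = []\<close>) is a path.\<close>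

definition path_graph :: "('v, 'e) mgraph \<Rightarrow> bool" where
  "path_graph P \<longleftrightarrow> (\<exists>vs es. distinct vs \<and> length vs = Suc (length es)
     \<and> verts P = set vs \<and> edges P = set es
     \<and> (\<forall>i < length es. ends P (es ! i) = {vs ! i, vs ! Suc i}))"

definition disjoint_union_of_paths_and_circles :: "('v, 'e) mgraph \<Rightarrow> bool" where
  "disjoint_union_of_paths_and_circles G \<longleftrightarrow>
     (\<exists>\<H>. (\<forall>H \<in> \<H>. subgraph H G \<and> (path_graph H \<or> circle_graph H))
        \<and> (\<forall>H \<in> \<H>. \<forall>K \<in> \<H>. H \<noteq> K \<longrightarrow> verts H \<inter> verts K = {})
        \<and> (\<Union>H \<in> \<H>. verts H) = verts G
        \<and> (\<Union>H \<in> \<H>. edges H) = edges G)"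

definition isthmus :: "('v, 'e) mgraph \<Rightarrow> 'e \<Rightarrow> bool" where
  "isthmus G e \<longleftrightarrow> e \<in> edges G \<and> (\<nexists>C. circle_of C G \<and> e \<in> edges C)"

definition balanced :: "('v, 'e) mgraph \<Rightarrow> ('e \<Rightarrow> int) \<Rightarrow> bool" where
  "balanced \<Gamma> \<sigma> \<longleftrightarrow> (\<forall>C. circle_of C \<Gamma> \<longrightarrow> (\<Prod>e \<in> edges C. \<sigma> e) = 1)"

definition positive_edges_at :: "('v, 'e) mgraph \<Rightarrow> ('e \<Rightarrow> int) \<Rightarrow> 'v \<Rightarrow> 'e set" where
  "positive_edges_at \<Gamma> \<sigma> v = {e \<in> incident_edges \<Gamma> v. \<sigma> e = 1}"

definition totally_positive :: "('v, 'e) mgraph \<Rightarrow> ('e \<Rightarrow> int) \<Rightarrow> 'v \<Rightarrow> bool" where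
  "totally_positive \<Gamma> \<sigma> v \<longleftrightarrow> (\<forall>e \<in> incident_edges \<Gamma> v. \<sigma> e = 1)"

definition negative_subgraph :: "('v, 'e) mgraph \<Rightarrow> ('e \<Rightarrow> int) \<Rightarrow> ('v, 'e) mgraph" where
  "negative_subgraph \<Gamma> \<sigma> = \<Gamma>\<lparr>edges := {e \<in> edges \<Gamma>. \<sigma> e = -1}\<rparr>"

definition delete_positive_isthmi :: "('v, 'e) mgraph \<Rightarrow> ('e \<Rightarrow> int) \<Rightarrow> ('v, 'e) mgraph" where
  "delete_positive_isthmi \<Gamma> \<sigma> = \<Gamma>\<lparr>edges := {e \<in> edges \<Gamma>. \<not> (\<sigma> e = 1 \<and> isthmus \<Gamma> e)}\<rparr>"

text \<open>An edge of the line graph is a pair consisting of its two endpoints \<open>{e, f}\<close> and the common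
  endpoint \<open>v\<close> of \<open>e\<close> and \<open>f\<close> that causes it; parallel \<open>e\<close> and \<open>f\<close> are thus joined twice.\<close>

definition line_graph :: "('v, 'e) mgraph \<Rightarrow> ('e, 'e set \<times> 'v) mgraph" where
  "line_graph \<Gamma> =
     \<lparr>verts = edges \<Gamma>,
      edges = {({e, f}, v) | e f v.
        e \<in> edges \<Gamma> \<and> f \<in> edges \<Gamma> \<and> e \<noteq> f \<and> v \<in> ends \<Gamma> e \<and> v \<in> ends \<Gamma> f},
      ends = fst\<rparr>"

definition consistent :: "('v, 'e) mgraph \<Rightarrow> ('v \<Rightarrow> int) \<Rightarrow> bool" where
  "consistent G \<tau> \<longleftrightarrow> (\<forall>C. circle_of C G \<longrightarrow> (\<Prod>v \<in> verts C. \<tau> v) = 1)"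

definition line_consistent :: "('v, 'e) mgraph \<Rightarrow> ('e \<Rightarrow> int) \<Rightarrow> bool" where
  "line_consistent \<Gamma> \<sigma> \<longleftrightarrow> consistent (line_graph \<Gamma>) \<sigma>"

lemma (in finite_loopless_multigraph) line_graph_multigraph:
  "finite_loopless_multigraph (line_graph \<Gamma>)"
proof
  have "edges (line_graph \<Gamma>) \<subseteq> Pow (edges \<Gamma>) \<times> verts \<Gamma>"
    using ends_in_verts by (auto simp: line_graph_def)
  then show "finite (edges (line_graph \<Gamma>))"
    using finite_edges finite_verts finite_subset by blast
qed (auto simp: line_graph_def finite_edges)

end

theory Submission
  imports Defs
begin

text \<open>A circle of \<open>\<Gamma>\<close> lifts to a circle of the line graph through the same edges, which gives
  balance. Three edges at a vertex form a triangle of the line graph, so that a vertex of degree at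
  least 3 is totally positive or has degree 3 and just one positive edge \<open>e\<close>. If a circle used
  \<open>e\<close> at such a vertex, its lift could also make a detour through the remaining negative edge there,
  which changes the sign; hence \<open>e\<close> is an isthmus.

  Conversely, given a circle of the line graph, the edges that it enters and leaves through different
  endpoints form an even set, i.e. an edge-disjoint union of circles of \<open>\<Gamma>\<close>; this set is positive
  by balance and contains no isthmus. A negative edge entered and left through the same endpoint
  \<open>v\<close> forces degree 3 at \<open>v\<close>; the positive isthmus there must then also be entered and left through
  \<open>v\<close>, and the circle closes up to the triangle at \<open>v\<close>, which is positive.\<close>

section \<open>Circles and paths\<close>

lemma sym_adjacency: "sym (adjacency G)"
  by (auto simp: sym_def adjacency_def insert_commute)

lemma connected_graphI:
  assumes "r \<in> verts G" "\<And>v. v \<in> verts G \<Longrightarrow> (r, v) \<in> (adjacency G)\<^sup>*"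
  shows "connected_graph G"
proof -
  have "(u, v) \<in> (adjacency G)\<^sup>*" if "u \<in> verts G" "v \<in> verts G" for u v
    using assms(2)[OF that(1)] assms(2)[OF that(2)] sym_rtrancl[OF sym_adjacency[of G]]
    by (meson rtrancl_trans symD)
  with assms(1) show ?thesis by (auto simp: connected_graph_def)
qed

lemma connected_graph_induct [consumes 3, case_names base step]:
  assumes "connected_graph G" "r \<in> verts G" "v \<in> verts G"
    and "P r"
    and "\<And>u w e. \<lbrakk>P u; e \<in> edges G; ends G e = {u, w}\<rbrakk> \<Longrightarrow> P w"
  shows "P v"
proof -
  have "(r, v) \<in> (adjacency G)\<^sup>*" using assms(1-3) by (simp add: connected_graph_def)
  then show ?thesis
    by induction (use assms(4,5) in \<open>auto simp: adjacency_def\<close>)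
qed

text \<open>The edges meeting the vertex of index \<open>i\<close> are those of index
  \<open>i\<close> and of its cyclic predecessor. These two indices differ because
  \<open>2 \<le> n\<close>; the case \<open>n = 2\<close> is the circle formed by two parallel
  edges.\<close>

lemma circle_graph_cyclic:
  assumes "distinct vs" "distinct fs" "length vs = n" "length fs = n" "2 \<le> n"
    and V: "verts C = set vs" and E: "edges C = set fs"
    and ends: "\<And>i. i < n \<Longrightarrow> ends C (fs ! i) = {vs ! i, vs ! (Suc i mod n)}"
  shows "circle_graph C"
proof -
  have "(vs ! 0, vs ! i) \<in> (adjacency C)\<^sup>*" if "i < n" for i
    using that
  proof (induction i)
    case (Suc i)
    then have "(vs ! i, vs ! Suc i) \<in> adjacency C"
      using ends[of i] E assms(4) by (auto simp: adjacency_def intro!: bexI[of _ "fs ! i"])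
    with Suc show ?case by (meson Suc_lessD rtrancl.rtrancl_into_rtrancl)
  qed simp
  then have "connected_graph C"
    using V assms(3,5) by (intro connected_graphI[of "vs ! 0"]) (auto simp: in_set_conv_nth intro: exI[of _ 0])
  moreover have "degree C v = 2" if v: "v \<in> verts C" for v
  proof -
    obtain i where i: "i < n" "v = vs ! i"
      using v V assms(3) by (auto simp: in_set_conv_nth)
    \<comment> \<open>The predecessor of \<open>i\<close> modulo \<open>n\<close>. The wrap-around
      at 0 is written out because subtraction on naturals truncates.\<close>
    define p where "p = (if i = 0 then n - 1 else i - 1)"
    have p: "p < n" "p \<noteq> i" using i assms(5) by (auto simp: p_def)
    have "v \<in> ends C (fs ! j) \<longleftrightarrow> j = i \<or> j = p" if "j < n" for j
    proof -
      have "Suc j mod n < n" using that by simp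
      then have "v \<in> ends C (fs ! j) \<longleftrightarrow> i = j \<or> i = Suc j mod n"
        using ends[OF that] i that assms(1,3) by (auto simp: nth_eq_iff_index_eq)
      also have "i = Suc j mod n \<longleftrightarrow> j = p"
        using that i assms(5) by (cases "Suc j = n") (auto simp: p_def)
      finally show ?thesis by auto
    qed
    then have "incident_edges C v = {fs ! i, fs ! p}"
      using E assms(4) i p by (auto simp: incident_edges_def in_set_conv_nth)
    moreover have "fs ! i \<noteq> fs ! p" using p i assms(2,4) by (simp add: nth_eq_iff_index_eq)
    ultimately show ?thesis by (simp add: degree_def)
  qed
  ultimately show ?thesis by (simp add: circle_graph_def)
qed

text \<open>At \<open>a\<close> and \<open>b\<close> the lost edge \<open>x\<close> is replaced by
  \<open>y\<close> or \<open>z\<close>, and the new vertex \<open>g\<close> meets exactly these two,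
  so all degrees stay 2. The walk from \<open>a\<close> through \<open>g\<close> to \<open>b\<close>
  replaces \<open>x\<close> in every connection. Applied inside a line graph, this yields the detour
  through one more edge.\<close>

lemma circle_graph_subdivide:
  assumes C: "circle_graph C" and x: "x \<in> edges C" "ends C x = {a, b}" "a \<noteq> b"
    and ab: "a \<in> verts C" "b \<in> verts C"
    and fin: "finite (edges C)" and sub: "\<And>e. e \<in> edges C \<Longrightarrow> ends C e \<subseteq> verts C"
    and g: "g \<notin> verts C" and yz: "y \<notin> edges C" "z \<notin> edges C" "y \<noteq> z"
    "ends C y = {a, g}" "ends C z = {g, b}"
  shows "circle_graph (C\<lparr>verts := insert g (verts C), edges := insert y (insert z (edges C - {x}))\<rparr>)"
    (is "circle_graph ?D")
proof -
  have ag: "(a, g) \<in> adjacency ?D" and gb: "(g, b) \<in> adjacency ?D"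
    and ga: "(g, a) \<in> adjacency ?D" and bg: "(b, g) \<in> adjacency ?D"
    using yz by (auto simp: adjacency_def insert_commute)
  have *: "(u, w) \<in> (adjacency ?D)\<^sup>*" if e: "e \<in> edges C" "ends C e = {u, w}" for u w e
  proof (cases "e = x")
    case True
    then have "u = a \<and> w = b \<or> u = b \<and> w = a" using e x by (auto simp: doubleton_eq_iff)
    then show ?thesis using ag gb ga bg by (meson r_into_rtrancl rtrancl_trans)
  next
    case False
    then show ?thesis using e by (intro r_into_rtrancl) (auto simp: adjacency_def)
  qed
  have "connected_graph ?D"
  proof (rule connected_graphI[of a])
    show "a \<in> verts ?D" using ab by simp
    fix v assume "v \<in> verts ?D"
    then consider "v = g" | "v \<in> verts C" by auto
    then show "(a, v) \<in> (adjacency ?D)\<^sup>*"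
    proof cases
      case 2
      show ?thesis
        using conjunct1[OF C[unfolded circle_graph_def]] ab(1) 2
      proof (induction rule: connected_graph_induct)
        case (step u w e)
        then show ?case using * by (blast intro: rtrancl_trans)
      qed simp
    qed (use ag in auto)
  qed
  moreover have "degree ?D v = 2" if v: "v \<in> verts ?D" for v
  proof -
    have deg: "card (incident_edges C v) = 2" if "v \<in> verts C"
      using C that by (simp add: circle_graph_def degree_def)
    have finI: "finite (incident_edges C v)" using fin by (simp add: incident_edges_def)
    have yzI: "y \<notin> incident_edges C v" "z \<notin> incident_edges C v"
      using yz by (auto simp: incident_edges_def)
    have swap: "card (insert y (incident_edges C v - {x})) = 2"
      "card (insert z (incident_edges C v - {x})) = 2" if "v \<in> {a, b}"
    proof -
      have "x \<in> incident_edges C v" "card (incident_edges C v) = 2"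
        using that x ab deg by (auto simp: incident_edges_def)
      then show "card (insert y (incident_edges C v - {x})) = 2"
        "card (insert z (incident_edges C v - {x})) = 2"
        using finI yzI by simp_all
    qed
    consider "v = g" | "v = a" | "v = b" | "v \<in> verts C" "v \<noteq> a" "v \<noteq> b" "v \<noteq> g"
      using v by auto
    then show ?thesis
    proof cases
      case 1
      then have "incident_edges ?D v = {y, z}"
        using sub g yz by (auto simp: incident_edges_def)
      then show ?thesis using yz by (simp add: degree_def)
    next
      case 2
      then have "incident_edges ?D v = insert y (incident_edges C v - {x})"
        using g ab x yz by (auto simp: incident_edges_def)
      then show ?thesis using swap 2 by (simp add: degree_def)
    next
      case 3
      then have "incident_edges ?D v = insert z (incident_edges C v - {x})"
        using g ab x yz by (auto simp: incident_edges_def)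
      then show ?thesis using swap 3 by (simp add: degree_def)
    next
      case 4
      then have "incident_edges ?D v = incident_edges C v"
        using x yz by (auto simp: incident_edges_def)
      then show ?thesis using deg 4 by (simp add: degree_def)
    qed
  qed
  ultimately show ?thesis by (simp add: circle_graph_def)
qed

text \<open>Whereas \<open>path_graph\<close> says that a whole graph is a path, this keeps the two
  lists inside an ambient graph, where a path can be prolonged, compared in length and closed up to
  a circle.\<close>

definition is_path :: "('v, 'e) mgraph \<Rightarrow> 'v list \<Rightarrow> 'e list \<Rightarrow> bool" where
  "is_path G vs es \<longleftrightarrow> distinct vs \<and> length vs = Suc (length es)
     \<and> set vs \<subseteq> verts G \<and> set es \<subseteq> edges G
     \<and> (\<forall>i < length es. ends G (es ! i) = {vs ! i, vs ! Suc i})"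

lemma is_path_Cons:
  assumes "is_path G vs es" "e \<in> edges G" "ends G e = {u, hd vs}" "u \<in> verts G" "u \<notin> set vs"
  shows "is_path G (u # vs) (e # es)"
  using assms by (cases vs) (auto simp: is_path_def nth_Cons split: nat.splits)

lemma is_path_incident_iff:
  assumes "is_path G vs es" "i < length vs" "j < length es"
  shows "vs ! i \<in> ends G (es ! j) \<longleftrightarrow> j = i \<or> Suc j = i"
  using assms by (auto simp: is_path_def nth_eq_iff_index_eq)

text \<open>Equal edges have equal end pairs. As the vertices are distinct, a crossed match of the
  pairs would need both \<open>i = Suc j\<close> and \<open>Suc i = j\<close>.\<close>

lemma is_path_distinct_edges:
  assumes "is_path G vs es"
  shows "distinct es"
  unfolding distinct_conv_nth
proof (intro allI impI notI)
  fix i j assume ij: "i < length es" "j < length es" "i \<noteq> j" "es ! i = es ! j"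
  then have "{vs ! i, vs ! Suc i} = {vs ! j, vs ! Suc j}" "distinct vs" "length vs = Suc (length es)"
    using assms unfolding is_path_def by metis+
  with ij show False by (auto simp: doubleton_eq_iff nth_eq_iff_index_eq)
qed

lemma path_graph_degree_le:
  assumes "path_graph P"
  shows "degree P v \<le> 2"
proof -
  obtain vs es where p: "is_path P vs es" "edges P = set es" "verts P = set vs"
    using assms by (auto simp: path_graph_def is_path_def)
  show ?thesis
  proof (cases "v \<in> verts P")
    case True
    then obtain i where "i < length vs" "v = vs ! i" using p by (auto simp: in_set_conv_nth)
    \<comment> \<open>For \<open>i = 0\<close> truncation makes both entries \<open>es ! 0\<close>;
      at the far end \<open>es ! i\<close> lies outside the list and is arbitrary. Both are
      harmless, since only an upper bound on the degree is wanted.\<close>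
    then have "incident_edges P v \<subseteq> {es ! i, es ! (i - 1)}"
      using is_path_incident_iff[OF p(1)] p(2)
      by (fastforce simp: incident_edges_def in_set_conv_nth)
    then have "degree P v \<le> card {es ! i, es ! (i - 1)}"
      unfolding degree_def by (intro card_mono) auto
    also have "\<dots> \<le> 2" by (simp add: card_insert_if)
    finally show ?thesis .
  next
    case False
    have "v \<notin> ends P e" if "e \<in> edges P" for e
    proof -
      have "e \<in> set es" using that p(2) by simp
      then obtain i where "i < length es" "e = es ! i" by (auto simp: in_set_conv_nth)
      then have "ends P e \<subseteq> verts P" using p(1,3) by (auto simp: is_path_def)
      then show ?thesis using False by blast
    qed
    then have "incident_edges P v = {}" by (auto simp: incident_edges_def)
    then show ?thesis by (simp add: degree_def)
  qed
qed

section \<open>Maximal paths, circles and even edge sets\<close>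

context finite_loopless_multigraph
begin

lemma finite_incident_edges [simp]: "finite (incident_edges \<Gamma> v)"
  using finite_edges by (simp add: incident_edges_def)

lemma other_end:
  assumes "e \<in> edges \<Gamma>" "v \<in> ends \<Gamma> e"
  obtains u where "ends \<Gamma> e = {u, v}" "u \<noteq> v" "u \<in> verts \<Gamma>"
proof -
  obtain a b where "ends \<Gamma> e = {a, b}" "a \<noteq> b"
    using card_ends[OF assms(1)] by (auto simp: card_2_iff)
  then show thesis using that assms(2) ends_in_verts[OF assms(1)]
    by (metis empty_iff insertI1 insert_commute insert_iff subset_iff)
qed

text \<open>A longest path among those with last vertex \<open>v\<close> works: an edge from its
  head to a new vertex could be prepended. Paths grow only at the head, so the other end can be
  prescribed.\<close>

lemma maximal_path:
  assumes "v \<in> verts \<Gamma>"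
  obtains vs es where "is_path \<Gamma> vs es" "last vs = v"
    "\<And>e. e \<in> edges \<Gamma> \<Longrightarrow> hd vs \<in> ends \<Gamma> e \<Longrightarrow> ends \<Gamma> e \<subseteq> set vs"
proof -
  let ?P = "\<lambda>(vs, es). is_path \<Gamma> vs es \<and> last vs = v"
  have "?P ([v], [])" using assms by (simp add: is_path_def)
  moreover have "\<forall>p. ?P p \<longrightarrow> length (fst p) < Suc (card (verts \<Gamma>))"
    using finite_verts by (auto simp: is_path_def less_Suc_eq_le) (metis card_mono distinct_card)
  ultimately have "\<exists>p. ?P p \<and> (\<forall>q. ?P q \<longrightarrow> length (fst q) \<le> length (fst p))"
    by (rule Lattices_Big.ex_has_greatest_nat)
  then obtain vs es where "?P (vs, es)" "\<forall>q. ?P q \<longrightarrow> length (fst q) \<le> length vs" by auto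
  then have p: "is_path \<Gamma> vs es" "last vs = v"
    and max: "\<And>vs' es'. is_path \<Gamma> vs' es' \<Longrightarrow> last vs' = v \<Longrightarrow> length vs' \<le> length vs"
    by auto
  have vs: "vs \<noteq> []" using p by (auto simp: is_path_def)
  show thesis
  proof (rule that[OF p])
    fix e assume e: "e \<in> edges \<Gamma>" "hd vs \<in> ends \<Gamma> e"
    then obtain u where u: "ends \<Gamma> e = {u, hd vs}" "u \<in> verts \<Gamma>" by (rule other_end)
    have "u \<in> set vs"
    proof (rule ccontr)
      assume "u \<notin> set vs"
      then have "is_path \<Gamma> (u # vs) (e # es)" using is_path_Cons p e u by metis
      then show False using max[of "u # vs"] p vs by fastforce
    qed
    then show "ends \<Gamma> e \<subseteq> set vs" using u vs by simp
  qed
qed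

lemma finite_loopless_multigraph_restrict:
  "T \<subseteq> edges \<Gamma> \<Longrightarrow> finite_loopless_multigraph (\<Gamma>\<lparr>edges := T\<rparr>)"
  using finite_verts finite_edges ends_in_verts card_ends
  by unfold_locales (auto intro: finite_subset)

lemma circle_of_edges_update_subset:
  "T \<subseteq> edges \<Gamma> \<Longrightarrow> circle_of C (\<Gamma>\<lparr>edges := T\<rparr>) \<Longrightarrow> circle_of C \<Gamma>"
  unfolding circle_of_def subgraph_def by fastforce

text \<open>The head of a maximal path has an edge and its degree is not 1, so there is a second
  edge besides the first path edge. By maximality that edge returns to the path and closes a
  circle.\<close>

lemma circle_exists:
  assumes "edges \<Gamma> \<noteq> {}" "\<And>v. degree \<Gamma> v \<noteq> 1"
  obtains C where "circle_of C \<Gamma>"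
proof -
  obtain e0 v where e0: "e0 \<in> edges \<Gamma>" "v \<in> ends \<Gamma> e0"
    using assms(1) card_ends by (metis all_not_in_conv card.empty zero_neq_numeral)
  then have "v \<in> verts \<Gamma>" using ends_in_verts by blast
  then obtain vs es where p: "is_path \<Gamma> vs es" "last vs = v"
    and max: "\<And>e. e \<in> edges \<Gamma> \<Longrightarrow> hd vs \<in> ends \<Gamma> e \<Longrightarrow> ends \<Gamma> e \<subseteq> set vs"
    by (rule maximal_path) blast
  have len: "length vs = Suc (length es)" and dvs: "distinct vs" using p by (auto simp: is_path_def)
  have hd: "hd vs = vs ! 0" using len by (cases vs) auto
  have "incident_edges \<Gamma> (hd vs) \<noteq> {}"
  proof (cases "es = []")
    case True
    then have "hd vs = v" using len p(2) by (cases vs) auto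
    then show ?thesis using e0 by (auto simp: incident_edges_def)
  next
    case False
    then have "es ! 0 \<in> incident_edges \<Gamma> (hd vs)"
      using p hd by (auto simp: incident_edges_def is_path_def)
    then show ?thesis by auto
  qed
  \<comment> \<open>For \<open>es = []\<close> the value \<open>es ! 0\<close> is arbitrary, but a
    nonempty set of cardinality other than 1 lies in no singleton anyway.\<close>
  then have "\<not> incident_edges \<Gamma> (hd vs) \<subseteq> {es ! 0}"
    using assms(2)[of "hd vs"] by (auto simp: degree_def subset_singleton_iff)
  then obtain f where f: "f \<in> edges \<Gamma>" "hd vs \<in> ends \<Gamma> f" "f \<noteq> es ! 0"
    by (auto simp: incident_edges_def)
  then obtain u where u: "ends \<Gamma> f = {u, hd vs}" "u \<noteq> hd vs" by (elim other_end)
  then obtain j where j: "j < length vs" "u = vs ! j" "j \<noteq> 0"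
    using max[OF f(1,2)] hd by (auto simp: in_set_conv_nth)
  \<comment> \<open>The circle consists of the first \<open>Suc j\<close> vertices, the first
    \<open>j\<close> path edges and the closing edge \<open>f\<close> from position \<open>j\<close>
    back to 0. If \<open>j = 1\<close>, then \<open>f\<close> is parallel to
    \<open>es ! 0\<close>.\<close>
  define n where "n = Suc j"
  let ?fs = "take j es @ [f]"
  let ?C = "\<Gamma>\<lparr>verts := set (take n vs), edges := set ?fs\<rparr>"
  have nth_fs: "?fs ! i = (if i < j then es ! i else f)" if "i < n" for i
    using that j len by (auto simp: nth_append n_def)
  \<comment> \<open>\<open>f\<close> contains the head, and \<open>es ! 0\<close>, from which
    \<open>f\<close> differs by choice, is the only path edge that does.\<close>
  have "f \<noteq> es ! i" if "i < length es" for i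
    using is_path_incident_iff[OF p(1), of 0 i] f that hd len by auto
  then have f_new: "f \<notin> set es" by (auto simp: in_set_conv_nth)
  have ends: "ends ?C (?fs ! i) = {take n vs ! i, take n vs ! (Suc i mod n)}" if "i < n" for i
  proof (cases "i < j")
    case True
    then show ?thesis using nth_fs[OF that] p(1) j len by (simp add: is_path_def n_def)
  next
    case False
    then have "i = j" using that by (simp add: n_def)
    then show ?thesis using nth_fs[OF that] u j hd by (simp add: n_def)
  qed
  have "circle_graph ?C"
  proof (rule circle_graph_cyclic[where n = n and vs = "take n vs" and fs = ?fs])
    show "distinct ?fs"
      using is_path_distinct_edges[OF p(1)] f_new by (auto dest: in_set_takeD)
    show "length (take n vs) = n" "length ?fs = n" "2 \<le> n"
      using j len by (auto simp: n_def)
  qed (use dvs ends in auto)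
  moreover have "\<forall>e \<in> edges ?C. ends ?C e \<subseteq> verts ?C"
  proof
    fix e assume e: "e \<in> edges ?C"
    have l: "length ?fs = n" "length (take n vs) = n" using j len by (auto simp: n_def)
    have "e \<in> set ?fs" using e by simp
    then obtain i where i: "i < n" "e = ?fs ! i" using l(1) unfolding in_set_conv_nth by blast
    have "Suc i mod n < n" using i(1) by simp
    then have "take n vs ! i \<in> set (take n vs)" "take n vs ! (Suc i mod n) \<in> set (take n vs)"
      using i(1) l(2) nth_mem[of _ "take n vs"] by presburger+
    then show "ends ?C e \<subseteq> verts ?C" using ends[OF i(1)] i(2) by simp
  qed
  moreover have "verts ?C \<subseteq> verts \<Gamma>" "edges ?C \<subseteq> edges \<Gamma>" "ends ?C = ends \<Gamma>"
    using p f by (auto simp: is_path_def dest: in_set_takeD)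
  ultimately have "circle_of ?C \<Gamma>" unfolding circle_of_def subgraph_def by blast
  then show thesis by (rule that)
qed

lemma circle_of_card_incident_edges:
  assumes "circle_of C \<Gamma>"
  shows "card (incident_edges C v) = (if v \<in> verts C then 2 else 0)"
proof (cases "v \<in> verts C")
  case False
  then have "incident_edges C v = {}"
    using assms by (fastforce simp: circle_of_def subgraph_def incident_edges_def)
  then show ?thesis using False by simp
qed (use assms in \<open>auto simp: circle_of_def circle_graph_def degree_def\<close>)

lemma circle_of_edges_nonempty:
  assumes "circle_of C \<Gamma>"
  shows "edges C \<noteq> {}"
proof -
  obtain v where "v \<in> verts C"
    using assms by (auto simp: circle_of_def circle_graph_def connected_graph_def)
  then have "card (incident_edges C v) \<noteq> 0"
    using circle_of_card_incident_edges[OF assms] by simp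
  then show ?thesis by (auto simp: incident_edges_def)
qed

lemma circle_of_other_edge:
  assumes "circle_of C \<Gamma>" "e \<in> edges C" "v \<in> ends \<Gamma> e"
  obtains f where "incident_edges C v = {e, f}" "f \<noteq> e"
proof -
  have "e \<in> incident_edges C v" "v \<in> verts C"
    using assms by (fastforce simp: incident_edges_def circle_of_def subgraph_def)+
  moreover from this(2) obtain x y where "incident_edges C v = {x, y}" "x \<noteq> y"
    using circle_of_card_incident_edges[OF assms(1), of v] by (auto simp: card_2_iff)
  ultimately show thesis using that by (metis insert_commute insert_iff singletonD)
qed

text \<open>A nonempty even set has no vertex of degree 1, hence contains a circle. Removing the
  circle lowers each degree by 0 or 2, so the rest is even again. This is the decomposition of an
  even set into edge-disjoint circles, put as an induction rule.\<close>

lemma even_edge_set_induct [consumes 2, case_names empty circle]: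
  assumes "T \<subseteq> edges \<Gamma>" "\<And>v. even (degree (\<Gamma>\<lparr>edges := T\<rparr>) v)"
    and empty: "P {}"
    and circle: "\<And>C S. \<lbrakk>circle_of C \<Gamma>; S \<subseteq> edges \<Gamma>; edges C \<inter> S = {}; P S\<rbrakk> \<Longrightarrow> P (edges C \<union> S)"
  shows "P T"
proof -
  have "finite T" using assms(1) finite_edges finite_subset by blast
  then show ?thesis
    using assms(1,2)
  proof (induction T rule: finite_psubset_induct)
    case (psubset T)
    show ?case
    proof (cases "T = {}")
      case False
      interpret T: finite_loopless_multigraph "\<Gamma>\<lparr>edges := T\<rparr>"
        using psubset.prems(1) by (rule finite_loopless_multigraph_restrict)
      have "degree (\<Gamma>\<lparr>edges := T\<rparr>) v \<noteq> 1" for v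
        using psubset.prems(2)[of v] by (metis odd_one)
      then obtain C where C: "circle_of C (\<Gamma>\<lparr>edges := T\<rparr>)"
        using T.circle_exists False by auto
      have CT: "edges C \<subseteq> T" and ends: "ends C = ends \<Gamma>"
        using C by (auto simp: circle_of_def subgraph_def)
      let ?S = "T - edges C"
      have "?S \<subset> T" using CT T.circle_of_edges_nonempty[OF C] by auto
      moreover have "even (degree (\<Gamma>\<lparr>edges := ?S\<rparr>) v)" for v
      proof -
        have "incident_edges (\<Gamma>\<lparr>edges := ?S\<rparr>) v = incident_edges (\<Gamma>\<lparr>edges := T\<rparr>) v - incident_edges C v"
          "incident_edges C v \<subseteq> incident_edges (\<Gamma>\<lparr>edges := T\<rparr>) v"
          using CT ends by (auto simp: incident_edges_def)
        then have "degree (\<Gamma>\<lparr>edges := ?S\<rparr>) v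
            = degree (\<Gamma>\<lparr>edges := T\<rparr>) v - card (incident_edges C v)"
          unfolding degree_def
          by (metis T.finite_incident_edges card_Diff_subset finite_subset)
        then show ?thesis
          using T.circle_of_card_incident_edges[OF C, of v] psubset.prems(2)[of v] by simp
      qed
      ultimately have "P ?S" using psubset.IH psubset.prems(1) by blast
      then have "P (edges C \<union> ?S)"
        using circle_of_edges_update_subset[OF psubset.prems(1) C] psubset.prems(1)
        by (intro circle) auto
      then show ?thesis using CT by (simp add: Un_absorb1)
    qed (simp add: empty)
  qed
qed

section \<open>Components of graphs with degrees at most 2\<close>

definition component :: "'v \<Rightarrow> ('v, 'e) mgraph" where
  "component v = \<lparr>verts = {u \<in> verts \<Gamma>. (v, u) \<in> (adjacency \<Gamma>)\<^sup>*},
     edges = {e \<in> edges \<Gamma>. \<exists>u \<in> ends \<Gamma> e. (v, u) \<in> (adjacency \<Gamma>)\<^sup>*}, ends = ends \<Gamma>\<rparr>"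

lemma reachable_edge:
  assumes "e \<in> edges \<Gamma>" "u \<in> ends \<Gamma> e" "w \<in> ends \<Gamma> e" "(v, u) \<in> (adjacency \<Gamma>)\<^sup>*"
  shows "(v, w) \<in> (adjacency \<Gamma>)\<^sup>*"
proof (cases "u = w")
  case False
  moreover obtain x where "ends \<Gamma> e = {x, u}" using assms(1,2) by (rule other_end)
  ultimately have "ends \<Gamma> e = {u, w}" using assms(3) by auto
  then have "(u, w) \<in> adjacency \<Gamma>" using assms(1) by (auto simp: adjacency_def)
  with assms(4) show ?thesis by (rule rtrancl_into_rtrancl)
qed (use assms in auto)

text \<open>\<open>component\<close> admits an edge as soon as one endpoint is reachable;
  \<open>reachable_edge\<close> then reaches the other endpoint too.\<close>

lemma subgraph_component: "subgraph (component v) \<Gamma>"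
proof -
  have "ends \<Gamma> e \<subseteq> verts (component v)" if "e \<in> edges (component v)" for e
    using that reachable_edge[of e] ends_in_verts[of e] unfolding component_def by auto
  then show ?thesis unfolding subgraph_def by (simp add: component_def)
qed

lemma connected_component:
  assumes "v \<in> verts \<Gamma>"
  shows "connected_graph (component v)"
proof (rule connected_graphI)
  show "v \<in> verts (component v)" using assms by (simp add: component_def)
  fix u assume "u \<in> verts (component v)"
  then have "(v, u) \<in> (adjacency \<Gamma>)\<^sup>*" by (simp add: component_def)
  then show "(v, u) \<in> (adjacency (component v))\<^sup>*"
  proof induction
    case (step u w)
    then have "(u, w) \<in> adjacency (component v)"
      by (auto simp: adjacency_def component_def)
    with step show ?case by simp
  qed simp
qed

lemma degree_component:
  "u \<in> verts (component v) \<Longrightarrow> degree (component v) u = degree \<Gamma> u"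
  by (auto simp: degree_def component_def incident_edges_def intro!: arg_cong[of _ _ card])

lemma is_path_reachable:
  assumes "is_path \<Gamma> vs es" "u \<in> set vs" "w \<in> set vs"
  shows "(u, w) \<in> (adjacency \<Gamma>)\<^sup>*"
proof -
  have *: "(vs ! 0, vs ! i) \<in> (adjacency \<Gamma>)\<^sup>*" if "i < length vs" for i
    using that
  proof (induction i)
    case (Suc i)
    then have "(vs ! i, vs ! Suc i) \<in> adjacency \<Gamma>"
      using assms(1) by (auto simp: is_path_def adjacency_def intro!: bexI[of _ "es ! i"])
    with Suc show ?case by (meson Suc_lessD rtrancl.rtrancl_into_rtrancl)
  qed simp
  have "(vs ! 0, u) \<in> (adjacency \<Gamma>)\<^sup>*" "(vs ! 0, w) \<in> (adjacency \<Gamma>)\<^sup>*"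
    using * assms(2,3) by (auto simp: in_set_conv_nth)
  then show ?thesis
    using sym_rtrancl[OF sym_adjacency[of \<Gamma>]] by (meson rtrancl_trans symD)
qed

text \<open>An inner vertex already has two path edges, and a last vertex different from the head
  already has one, so the degree bounds leave no room for a further edge there (\<open>pos\<close>).
  An edge at the head has, by maximality and the absence of loops, its other endpoint at a positive
  index, where \<open>pos\<close> applies.\<close>

lemma maximal_path_absorbs_edges:
  assumes p: "is_path \<Gamma> vs es"
    and last: "degree \<Gamma> (last vs) \<le> 1"
    and deg: "\<And>v. degree \<Gamma> v \<le> 2"
    and max: "\<And>e. e \<in> edges \<Gamma> \<Longrightarrow> hd vs \<in> ends \<Gamma> e \<Longrightarrow> ends \<Gamma> e \<subseteq> set vs"
    and e: "e \<in> edges \<Gamma>" "ends \<Gamma> e \<inter> set vs \<noteq> {}"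
  shows "e \<in> set es"
proof -
  have len: "length vs = Suc (length es)" and dvs: "distinct vs" and es: "set es \<subseteq> edges \<Gamma>"
    using p by (auto simp: is_path_def)
  have pos: "f \<in> set es" if f: "f \<in> edges \<Gamma>" "vs ! i \<in> ends \<Gamma> f" and i: "0 < i" "i < length vs" for f i
  proof (rule ccontr)
    assume nf: "f \<notin> set es"
    show False
    proof (cases "i = length es")
      case True
      then have "last vs = vs ! i" using len by (metis diff_Suc_1 last_conv_nth list.size(3) nat.distinct(1))
      moreover have "es ! (i - 1) \<in> edges \<Gamma>" "vs ! i \<in> ends \<Gamma> (es ! (i - 1))"
        using es is_path_incident_iff[OF p, of i "i - 1"] i True by auto
      ultimately have "{f, es ! (i - 1)} \<subseteq> incident_edges \<Gamma> (last vs)"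
        using f by (auto simp: incident_edges_def)
      moreover have "es ! (i - 1) \<in> set es" using i True by simp
      then have "card {f, es ! (i - 1)} = 2" using nf by (auto simp: card_insert_if)
      ultimately have "2 \<le> degree \<Gamma> (last vs)"
        unfolding degree_def by (metis card_mono finite_incident_edges)
      then show False using last by simp
    next
      case False
      then have il: "i < length es" using i len by simp
      have "es ! (i - 1) \<in> incident_edges \<Gamma> (vs ! i)" "es ! i \<in> incident_edges \<Gamma> (vs ! i)"
        using es is_path_incident_iff[OF p, of i "i - 1"] is_path_incident_iff[OF p, of i i] i il
        by (auto simp: incident_edges_def)
      then have "{f, es ! (i - 1), es ! i} \<subseteq> incident_edges \<Gamma> (vs ! i)"
        using f by (auto simp: incident_edges_def)
      moreover have "es ! (i - 1) \<noteq> es ! i"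
        using is_path_distinct_edges[OF p] i il by (simp add: nth_eq_iff_index_eq)
      then have "card {f, es ! (i - 1), es ! i} = 3"
        using nf i il by (auto simp: card_insert_if)
      ultimately have "3 \<le> degree \<Gamma> (vs ! i)"
        unfolding degree_def by (metis card_mono finite_incident_edges)
      then show False using deg[of "vs ! i"] by simp
    qed
  qed
  obtain i where i: "i < length vs" "vs ! i \<in> ends \<Gamma> e"
    using e(2) by (auto simp: in_set_conv_nth)
  show ?thesis
  proof (cases "i = 0")
    case True
    then have hd: "hd vs \<in> ends \<Gamma> e" "hd vs = vs ! 0" using i len by (cases vs; auto)+
    then obtain u where u: "ends \<Gamma> e = {u, hd vs}" "u \<noteq> hd vs" using e(1) by (elim other_end)
    then obtain j where j: "j < length vs" "u = vs ! j"
      using max[OF e(1) hd(1)] by (auto simp: in_set_conv_nth)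
    then have "0 < j" using u(2) hd(2) by (cases j) auto
    then show ?thesis using pos[OF e(1), of j] j u by simp
  qed (use pos[OF e(1), of i] i in auto)
qed

text \<open>If all degrees are 2, connectedness makes the component a circle. Otherwise some vertex
  \<open>u\<close> has degree at most 1, and a maximal path ending at \<open>u\<close> absorbs every
  edge that it meets, so it exhausts the component.\<close>

lemma component_path_or_circle:
  assumes v: "v \<in> verts \<Gamma>" and deg: "\<And>v. degree \<Gamma> v \<le> 2"
  shows "path_graph (component v) \<or> circle_graph (component v)"
proof (cases "\<forall>u \<in> verts (component v). degree \<Gamma> u = 2")
  case True
  then show ?thesis using connected_component[OF v] by (simp add: circle_graph_def degree_component)
next
  case False
  then obtain u where u: "u \<in> verts (component v)" "degree \<Gamma> u \<le> 1"
    using deg by (metis One_nat_def Suc_1 le_SucE)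
  then have "u \<in> verts \<Gamma>" by (simp add: component_def)
  then obtain vs es where p: "is_path \<Gamma> vs es" "last vs = u"
    and max: "\<And>e. e \<in> edges \<Gamma> \<Longrightarrow> hd vs \<in> ends \<Gamma> e \<Longrightarrow> ends \<Gamma> e \<subseteq> set vs"
    by (rule maximal_path) blast
  have absorb: "e \<in> set es" if "e \<in> edges \<Gamma>" "ends \<Gamma> e \<inter> set vs \<noteq> {}" for e
    using maximal_path_absorbs_edges[OF p(1) _ deg max that] u p(2) by simp
  have "vs \<noteq> []" using p by (auto simp: is_path_def)
  then have uvs: "u \<in> set vs" using p(2) last_in_set by blast
  have "verts (component v) \<subseteq> set vs"
  proof
    fix w assume "w \<in> verts (component v)"
    with connected_component[OF v] u(1) show "w \<in> set vs"
    proof (induction rule: connected_graph_induct)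
      case (step a b e)
      then have "e \<in> edges \<Gamma>" "ends \<Gamma> e = {a, b}" by (auto simp: component_def)
      then have "e \<in> set es" using absorb step by auto
      then obtain i where "i < length es" "e = es ! i" by (auto simp: in_set_conv_nth)
      then have "ends \<Gamma> e \<subseteq> set vs" using p(1) by (auto simp: is_path_def)
      then show ?case using \<open>ends \<Gamma> e = {a, b}\<close> by simp
    qed (rule uvs)
  qed
  moreover have "set vs \<subseteq> verts (component v)"
  proof
    fix w assume w: "w \<in> set vs"
    have "(u, w) \<in> (adjacency \<Gamma>)\<^sup>*" using is_path_reachable[OF p(1) uvs w] .
    moreover have "(v, u) \<in> (adjacency \<Gamma>)\<^sup>*" using u(1) by (simp add: component_def)
    ultimately show "w \<in> verts (component v)"
      using p(1) w by (auto simp: component_def is_path_def)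
  qed
  ultimately have V: "verts (component v) = set vs" by blast
  have "edges (component v) = set es"
  proof (intro set_eqI iffI)
    fix e assume "e \<in> edges (component v)"
    then obtain w where "e \<in> edges \<Gamma>" "w \<in> ends \<Gamma> e" "w \<in> verts (component v)"
      using ends_in_verts by (auto simp: component_def)
    then show "e \<in> set es" using absorb V by auto
  next
    fix e assume e: "e \<in> set es"
    then obtain i where "i < length es" "e = es ! i" by (auto simp: in_set_conv_nth)
    then have "vs ! i \<in> ends \<Gamma> e" "vs ! i \<in> set vs" using p(1) by (auto simp: is_path_def)
    then show "e \<in> edges (component v)"
      using e p(1) unfolding V[symmetric] by (auto simp: component_def is_path_def)
  qed
  with V p(1) have "path_graph (component v)"
    unfolding path_graph_def is_path_def by (auto simp: component_def)
  then show ?thesis ..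
qed

text \<open>Replaces the decomposition by a degree bound that can be counted with. The components
  serve as the pieces in one direction; in the other, a vertex has all its edges inside the single
  piece that contains it.\<close>

lemma disjoint_union_of_paths_and_circles_iff:
  "disjoint_union_of_paths_and_circles \<Gamma> \<longleftrightarrow> (\<forall>v. degree \<Gamma> v \<le> 2)"
proof
  assume "\<forall>v. degree \<Gamma> v \<le> 2"
  then have deg: "\<And>v. degree \<Gamma> v \<le> 2" by blast
  show "disjoint_union_of_paths_and_circles \<Gamma>"
    unfolding disjoint_union_of_paths_and_circles_def
  proof (intro exI[of _ "component ` verts \<Gamma>"] conjI ballI impI)
    show "subgraph H \<Gamma>" if "H \<in> component ` verts \<Gamma>" for H
      using that subgraph_component by auto
    show "path_graph H \<or> circle_graph H" if "H \<in> component ` verts \<Gamma>" for H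
      using that component_path_or_circle deg by auto
    show "verts H \<inter> verts K = {}"
      if HK: "H \<in> component ` verts \<Gamma>" "K \<in> component ` verts \<Gamma>" "H \<noteq> K" for H K
    proof (rule ccontr)
      assume "verts H \<inter> verts K \<noteq> {}"
      then obtain u where u: "u \<in> verts H" "u \<in> verts K" by blast
      obtain v w where vw: "H = component v" "K = component w" using HK by blast
      have "(v, u) \<in> (adjacency \<Gamma>)\<^sup>*" "(w, u) \<in> (adjacency \<Gamma>)\<^sup>*"
        using u unfolding vw component_def by simp_all
      then have "(v, w) \<in> (adjacency \<Gamma>)\<^sup>*" "(w, v) \<in> (adjacency \<Gamma>)\<^sup>*"
        using sym_rtrancl[OF sym_adjacency[of \<Gamma>]] by (meson rtrancl_trans symD)+
      \<comment> \<open>A common vertex gives \<open>v\<close> and \<open>w\<close> the same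
        reachable vertices, which makes the two component records equal.\<close>
      then have "(v, x) \<in> (adjacency \<Gamma>)\<^sup>* \<longleftrightarrow> (w, x) \<in> (adjacency \<Gamma>)\<^sup>*" for x
        by (meson rtrancl_trans)
      then show False using vw HK(3) by (simp add: component_def)
    qed
    show "(\<Union>H \<in> component ` verts \<Gamma>. verts H) = verts \<Gamma>"
      by (auto simp: component_def)
    show "(\<Union>H \<in> component ` verts \<Gamma>. edges H) = edges \<Gamma>"
    proof
      show "edges \<Gamma> \<subseteq> (\<Union>H \<in> component ` verts \<Gamma>. edges H)"
      proof
        fix e assume e: "e \<in> edges \<Gamma>"
        then obtain v where "v \<in> ends \<Gamma> e"
          using card_ends by (metis all_not_in_conv card.empty zero_neq_numeral)
        with e show "e \<in> (\<Union>H \<in> component ` verts \<Gamma>. edges H)"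
          using ends_in_verts by (auto simp: component_def intro!: bexI[of _ v])
      qed
    qed (auto simp: component_def)
  qed
next
  assume "disjoint_union_of_paths_and_circles \<Gamma>"
  then obtain \<H>
    where \<H>: "\<forall>H \<in> \<H>. subgraph H \<Gamma> \<and> (path_graph H \<or> circle_graph H)"
      "\<forall>H \<in> \<H>. \<forall>K \<in> \<H>. H \<noteq> K \<longrightarrow> verts H \<inter> verts K = {}"
    and V: "(\<Union>H \<in> \<H>. verts H) = verts \<Gamma>" and E: "(\<Union>H \<in> \<H>. edges H) = edges \<Gamma>"
    unfolding disjoint_union_of_paths_and_circles_def by (elim exE conjE) (rule that)
  have sub: "subgraph H \<Gamma>" and pc: "path_graph H \<or> circle_graph H" if "H \<in> \<H>" for H
    using \<H>(1) that by simp_all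
  have disj: "verts H \<inter> verts K = {}" if "H \<in> \<H>" "K \<in> \<H>" "H \<noteq> K" for H K
    using \<H>(2) that by simp
  show "\<forall>v. degree \<Gamma> v \<le> 2"
  proof
    fix v
    show "degree \<Gamma> v \<le> 2"
    proof (cases "v \<in> verts \<Gamma>")
      case False
      then have "incident_edges \<Gamma> v = {}" using ends_in_verts by (auto simp: incident_edges_def)
      then show ?thesis by (simp add: degree_def)
    next
      case True
      then obtain H where H: "H \<in> \<H>" "v \<in> verts H" using V by blast
      \<comment> \<open>The piece \<open>K\<close> that owns an edge at \<open>v\<close> contains
        \<open>v\<close> as well, so disjointness forces \<open>K = H\<close>.\<close>
      have "incident_edges \<Gamma> v \<subseteq> incident_edges H v"
      proof
        fix e assume "e \<in> incident_edges \<Gamma> v"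
        then have e: "e \<in> edges \<Gamma>" "v \<in> ends \<Gamma> e" by (auto simp: incident_edges_def)
        then obtain K where K: "K \<in> \<H>" "e \<in> edges K" using E by blast
        then have "v \<in> verts K" "ends H = ends \<Gamma>"
          using sub[OF K(1)] sub[OF H(1)] e unfolding subgraph_def by (metis subsetD)+
        moreover from this(1) have "K = H" using disj[OF H(1) K(1)] H(2) by blast
        ultimately show "e \<in> incident_edges H v" using K(2) e(2) by (simp add: incident_edges_def)
      qed
      moreover have "incident_edges H v \<subseteq> incident_edges \<Gamma> v"
        using sub[OF H(1)] unfolding incident_edges_def subgraph_def by auto
      ultimately have "degree \<Gamma> v = degree H v" by (simp add: degree_def)
      also have "\<dots> \<le> 2"
        using pc[OF H(1)] H(2) path_graph_degree_le by (auto simp: circle_graph_def)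
      finally show ?thesis .
    qed
  qed
qed

end

section \<open>Circles of the line graph\<close>

lemma line_graph_edge_iff [simp]:
  "({e, f}, v) \<in> edges (line_graph G) \<longleftrightarrow>
     e \<in> edges G \<and> f \<in> edges G \<and> e \<noteq> f \<and> v \<in> ends G e \<and> v \<in> ends G f"
  by (auto simp: line_graph_def doubleton_eq_iff)

lemma line_graph_edgeE:
  assumes "x \<in> edges (line_graph G)"
  obtains e f v where "x = ({e, f}, v)" "e \<in> edges G" "f \<in> edges G" "e \<noteq> f"
    "v \<in> ends G e" "v \<in> ends G f"
  using assms by (auto simp: line_graph_def)

lemma verts_line_graph [simp]: "verts (line_graph G) = edges G"
  and ends_line_graph [simp]: "ends (line_graph G) = fst"
  by (simp_all add: line_graph_def)

lemma line_graph_adjacent: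
  assumes "e \<in> edges G" "f \<in> edges G" "v \<in> ends G e" "v \<in> ends G f"
  shows "(e, f) \<in> (adjacency (line_graph G))\<^sup>*"
proof (cases "e = f")
  case False
  then have "({e, f}, v) \<in> edges (line_graph G)" using assms by simp
  then have "(e, f) \<in> adjacency (line_graph G)"
    unfolding adjacency_def mem_Collect_eq prod.case ends_line_graph by (metis fst_conv)
  then show ?thesis by (rule r_into_rtrancl)
qed simp

text \<open>The induction runs over the vertices of \<open>G\<close>, starting at an endpoint
  \<open>r\<close> of \<open>e0\<close>, and shows that every edge at the current vertex is
  reachable from \<open>e0\<close>. Crossing an edge \<open>g\<close> from \<open>u\<close> to
  \<open>w\<close> preserves this, because all edges at \<open>w\<close> share \<open>w\<close> with
  \<open>g\<close>.\<close>

lemma connected_line_graph: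
  assumes conn: "connected_graph G" and ne: "edges G \<noteq> {}"
    and ends: "\<And>e. e \<in> edges G \<Longrightarrow> ends G e \<noteq> {} \<and> ends G e \<subseteq> verts G"
  shows "connected_graph (line_graph G)"
proof -
  obtain e0 r where e0: "e0 \<in> edges G" "r \<in> ends G e0" using ne ends by blast
  have reach: "\<forall>e \<in> edges G. v \<in> ends G e \<longrightarrow> (e0, e) \<in> (adjacency (line_graph G))\<^sup>*"
    if "v \<in> verts G" for v
  proof -
    have "r \<in> verts G" using e0 ends by blast
    from conn this that show ?thesis
    proof (induction rule: connected_graph_induct)
      case base
      then show ?case using e0 line_graph_adjacent by metis
    next
      case (step u w g)
      then have "(e0, g) \<in> (adjacency (line_graph G))\<^sup>*" by simp
      then show ?case using step(2,3) line_graph_adjacent[OF step(2)] by (auto intro: rtrancl_trans)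
    qed
  qed
  show ?thesis
  proof (rule connected_graphI)
    show "e0 \<in> verts (line_graph G)" using e0 by simp
    fix e assume "e \<in> verts (line_graph G)"
    then show "(e0, e) \<in> (adjacency (line_graph G))\<^sup>*"
      using ends[of e] reach by auto
  qed
qed

section \<open>Line graph circles constructed from the multigraph\<close>

context finite_loopless_multigraph
begin

text \<open>An edge of \<open>C\<close> with endpoints \<open>u\<close> and \<open>w\<close> has one
  successor \<open>f\<close> at \<open>u\<close> and one successor \<open>g\<close> at
  \<open>w\<close>, hence degree 2 in \<open>line_graph C\<close>. If \<open>C\<close> has length 2,
  then \<open>f = g\<close>, but the labels \<open>u\<close> and \<open>w\<close> keep the two joins
  apart.\<close>

lemma circle_of_line_graph:
  assumes C: "circle_of C \<Gamma>"
  shows "circle_of (line_graph C) (line_graph \<Gamma>)"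
proof -
  have sub: "edges C \<subseteq> edges \<Gamma>" "ends C = ends \<Gamma>" "\<forall>e \<in> edges C. ends \<Gamma> e \<subseteq> verts C"
    and conn: "connected_graph C"
    using C unfolding circle_of_def subgraph_def circle_graph_def by metis+
  have "connected_graph (line_graph C)"
  proof (rule connected_line_graph[OF conn circle_of_edges_nonempty[OF C]])
    fix e assume e: "e \<in> edges C"
    then have "card (ends \<Gamma> e) = 2" using sub(1) card_ends by blast
    then show "ends C e \<noteq> {} \<and> ends C e \<subseteq> verts C" using e sub(2,3) by auto
  qed
  moreover have "degree (line_graph C) e = 2" if "e \<in> edges C" for e
  proof -
    have "e \<in> edges \<Gamma>" using that sub(1) by blast
    then obtain u w where ends: "ends \<Gamma> e = {u, w}" "u \<noteq> w"
      using card_ends by (metis card_2_iff)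
    obtain f where f: "incident_edges C u = {e, f}" "f \<noteq> e"
      using circle_of_other_edge[OF C \<open>e \<in> edges C\<close>, of u] ends by auto
    obtain g where g: "incident_edges C w = {e, g}" "g \<noteq> e"
      using circle_of_other_edge[OF C \<open>e \<in> edges C\<close>, of w] ends by auto
    have "x = ({e, f}, u) \<or> x = ({e, g}, w)" if x: "x \<in> incident_edges (line_graph C) e" for x
    proof -
      obtain h v where h: "x = ({e, h}, v)" "h \<in> edges C" "h \<noteq> e" "v \<in> ends \<Gamma> e" "v \<in> ends \<Gamma> h"
      proof -
        have "x \<in> edges (line_graph C)" "e \<in> fst x" using x by (simp_all add: incident_edges_def)
        then obtain a b v where ab: "x = ({a, b}, v)" "a \<in> edges C" "b \<in> edges C" "a \<noteq> b"
          "v \<in> ends \<Gamma> a" "v \<in> ends \<Gamma> b" "e \<in> {a, b}"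
          using sub(2) by (metis fst_conv line_graph_edgeE)
        show thesis
        proof (cases "a = e")
          case True
          then show thesis using ab that[of b v] by simp
        next
          case False
          then show thesis using ab that[of a v] by (simp add: insert_commute)
        qed
      qed
      then have "h \<in> incident_edges C v" using sub(2) by (simp add: incident_edges_def)
      then show ?thesis using h f g ends by auto
    qed
    moreover have "({e, f}, u) \<in> incident_edges (line_graph C) e"
      "({e, g}, w) \<in> incident_edges (line_graph C) e"
      using f g by (auto simp: incident_edges_def)
    ultimately have "incident_edges (line_graph C) e = {({e, f}, u), ({e, g}, w)}" by blast
    then show ?thesis using ends(2) by (simp add: degree_def)
  qed
  moreover have "edges (line_graph C) \<subseteq> edges (line_graph \<Gamma>)"
    using sub(1,2) by (auto elim!: line_graph_edgeE)
  ultimately show ?thesis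
    using sub(1) by (auto simp: circle_of_def subgraph_def circle_graph_def elim!: line_graph_edgeE)
qed

text \<open>All three joins are taken at \<open>v\<close>, even if some of the edges are parallel
  and meet at another vertex too; their endpoint pairs tell them apart.\<close>

lemma line_graph_triangle:
  assumes "{e, f, g} \<subseteq> incident_edges \<Gamma> v" "e \<noteq> f" "f \<noteq> g" "e \<noteq> g"
  obtains D where "circle_of D (line_graph \<Gamma>)" "verts D = {e, f, g}"
proof
  let ?D = "\<lparr>verts = {e, f, g}, edges = {({e, f}, v), ({f, g}, v), ({g, e}, v)}, ends = fst\<rparr>"
  let ?fs = "[({e, f}, v), ({f, g}, v), ({g, e}, v)]"
  have "ends ?D (?fs ! i) = {[e, f, g] ! i, [e, f, g] ! (Suc i mod 3)}" if "i < 3" for i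
  proof -
    have "i = 0 \<or> i = 1 \<or> i = 2" using that by linarith
    then show ?thesis by (elim disjE) simp_all
  qed
  then have "circle_graph ?D"
    by (intro circle_graph_cyclic[of "[e, f, g]" ?fs 3])
      (use assms(2-4) in \<open>simp_all add: doubleton_eq_iff\<close>)
  then show "circle_of ?D (line_graph \<Gamma>)"
    using assms by (auto simp: circle_of_def subgraph_def incident_edges_def)
  show "verts ?D = {e, f, g}" by simp
qed

text \<open>The lift of \<open>C\<close> passes from \<open>e\<close> to \<open>f\<close> by the
  join labelled \<open>v\<close>. As \<open>g\<close> also contains \<open>v\<close> and is not on
  \<open>C\<close>, that join can be subdivided by \<open>g\<close>.\<close>

lemma line_graph_circle_detour:
  assumes C: "circle_of C \<Gamma>" and ef: "{e, f} \<subseteq> incident_edges C v" "e \<noteq> f"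
    and g: "g \<in> incident_edges \<Gamma> v" "g \<notin> edges C"
  obtains D where "circle_of D (line_graph \<Gamma>)" "verts D = insert g (edges C)"
proof
  let ?L = "line_graph C"
  let ?D = "?L\<lparr>verts := insert g (verts ?L),
    edges := insert ({e, g}, v) (insert ({g, f}, v) (edges ?L - {({e, f}, v)}))\<rparr>"
  have L: "circle_graph ?L" "edges ?L \<subseteq> edges (line_graph \<Gamma>)"
    using circle_of_line_graph[OF C] by (auto simp only: circle_of_def subgraph_def)
  have sub: "edges C \<subseteq> edges \<Gamma>" "ends C = ends \<Gamma>"
    using C by (auto simp only: circle_of_def subgraph_def)
  have finL: "finite (edges ?L)"
    using L(2) finite_subset finite_loopless_multigraph.finite_edges[OF line_graph_multigraph] by blast
  have "circle_graph ?D"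
    by (rule circle_graph_subdivide[OF L(1), where x = "({e, f}, v)"])
      (use ef g finL in \<open>auto simp: incident_edges_def doubleton_eq_iff elim!: line_graph_edgeE\<close>)
  moreover have "edges ?D \<subseteq> edges (line_graph \<Gamma>)"
    using L(2) ef g sub by (auto simp: incident_edges_def)
  moreover have "\<forall>x \<in> edges ?D. fst x \<subseteq> verts ?D"
    using ef by (auto simp: incident_edges_def elim!: line_graph_edgeE)
  moreover have "verts ?D \<subseteq> edges \<Gamma>" using g sub(1) by (auto simp: incident_edges_def)
  ultimately show "circle_of ?D (line_graph \<Gamma>)" by (simp add: circle_of_def subgraph_def)
  show "verts ?D = insert g (edges C)" by simp
qed

end

section \<open>Arbitrary circles of the line graph\<close>

locale line_graph_circle = finite_loopless_multigraph \<Gamma>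
  for \<Gamma> :: "('v, 'e) mgraph" +
  fixes D :: "('e, 'e set \<times> 'v) mgraph"
  assumes D: "circle_of D (line_graph \<Gamma>)"
begin

text \<open>These are the steps of the circle \<open>D\<close> into or out of \<open>e\<close> that
  pass through the endpoint \<open>v\<close>. Two of them at one endpoint mean that \<open>D\<close>
  turns back at \<open>e\<close>.\<close>

definition links :: "'e \<Rightarrow> 'v \<Rightarrow> ('e set \<times> 'v) set" where
  "links e v = {x \<in> edges D. e \<in> fst x \<and> snd x = v}"

text \<open>Along the circle, an edge of the multigraph is either entered and left through different
  endpoints, or entered and left through the same endpoint. The former are those with an odd number
  of links (namely one) at each endpoint.\<close>

definition traversed :: "'e set" where
  "traversed = {e \<in> verts D. \<exists>v. odd (card (links e v))}"

lemma verts_D: "verts D \<subseteq> edges \<Gamma>" and edges_D: "edges D \<subseteq> edges (line_graph \<Gamma>)"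
  and ends_D: "ends D = fst" and fst_D: "x \<in> edges D \<Longrightarrow> fst x \<subseteq> verts D"
  and connected_D: "connected_graph D"
proof -
  have *: "subgraph D (line_graph \<Gamma>)" "circle_graph D" using D by (simp_all add: circle_of_def)
  then show "verts D \<subseteq> edges \<Gamma>" "edges D \<subseteq> edges (line_graph \<Gamma>)" and ends: "ends D = fst"
    and "connected_graph D"
    by (simp_all add: subgraph_def circle_graph_def)
  show "fst x \<subseteq> verts D" if "x \<in> edges D"
    using * that unfolding subgraph_def ends by blast
qed

lemma finite_edges_D: "finite (edges D)" and finite_verts_D: "finite (verts D)"
  using edges_D verts_D finite_edges finite_subset
    finite_loopless_multigraph.finite_edges[OF line_graph_multigraph] by blast+

lemma linkE:
  assumes "x \<in> links e v"
  obtains f where "x = ({e, f}, v)" "f \<noteq> e" "f \<in> verts D"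
    "e \<in> incident_edges \<Gamma> v" "f \<in> incident_edges \<Gamma> v"
proof -
  have x: "x \<in> edges D" "x \<in> edges (line_graph \<Gamma>)" "e \<in> fst x" "snd x = v"
    using assms edges_D by (auto simp: links_def)
  from x(2) obtain a b where ab: "x = ({a, b}, v)" "a \<noteq> b" "{a, b} \<subseteq> incident_edges \<Gamma> v"
    by (rule line_graph_edgeE) (use x(4) in \<open>auto simp: incident_edges_def\<close>)
  moreover have "{a, b} \<subseteq> verts D" using fst_D[OF x(1)] ab(1) by simp
  ultimately show thesis using x(3) that
    by (metis empty_iff fst_conv insert_commute insert_iff subset_iff)
qed

lemma links_empty: "v \<notin> ends \<Gamma> e \<Longrightarrow> links e v = {}"
  by (auto elim!: linkE simp: incident_edges_def)

text \<open>\<open>e\<close> has degree 2 in \<open>D\<close>, and each of its two joins is labelled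
  by exactly one endpoint. The two counts are therefore 1 and 1, or 2 and 0 in some order.\<close>

lemma card_links:
  assumes "e \<in> verts D" "ends \<Gamma> e = {u, w}" "u \<noteq> w"
  shows "card (links e u) + card (links e w) = 2"
proof -
  have "x \<in> links e u \<union> links e w" if x: "x \<in> incident_edges D e" for x
  proof -
    have "x \<in> links e (snd x)" using x by (simp add: incident_edges_def links_def ends_D)
    then show ?thesis using links_empty[of "snd x" e] assms(2) by auto
  qed
  moreover have "links e u \<union> links e w \<subseteq> incident_edges D e"
    by (auto simp: incident_edges_def links_def ends_D)
  ultimately have "incident_edges D e = links e u \<union> links e w" by blast
  moreover have "card (incident_edges D e) = 2"
    using assms(1) D by (simp add: circle_of_def circle_graph_def degree_def)
  moreover have "links e u \<inter> links e w = {}" using assms(3) by (auto simp: links_def)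
  moreover have "finite (links e u)" "finite (links e w)"
    using finite_edges_D by (simp_all add: links_def)
  ultimately show ?thesis by (simp add: card_Un_disjoint)
qed

text \<open>Modulo 2, the degree of the traversed edges at \<open>v\<close> is the sum of
  \<open>card (links e v)\<close> over all \<open>e\<close> on \<open>D\<close>, and that sum is
  even by a handshake count.\<close>

lemma even_traversed: "even (degree (\<Gamma>\<lparr>edges := traversed\<rparr>) v)"
proof -
  have "incident_edges (\<Gamma>\<lparr>edges := traversed\<rparr>) v = {e \<in> verts D. odd (card (links e v))}"
  proof (intro set_eqI iffI)
    fix e assume "e \<in> incident_edges (\<Gamma>\<lparr>edges := traversed\<rparr>) v"
    then obtain w where e: "e \<in> verts D" "v \<in> ends \<Gamma> e" "odd (card (links e w))"
      by (auto simp: incident_edges_def traversed_def)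
    then have "e \<in> edges \<Gamma>" using verts_D by blast
    then obtain u where u: "ends \<Gamma> e = {u, v}" "u \<noteq> v" using e(2) by (rule other_end)
    \<comment> \<open>The oddness is witnessed at some endpoint \<open>w\<close>; since the counts
      at the two endpoints add up to 2, it holds at \<open>v\<close> as well.\<close>
    have "w \<in> ends \<Gamma> e" using links_empty[of w e] e(3) by fastforce
    then have "odd (card (links e v))"
      using card_links[OF e(1) u] e(3) u by (metis even_add even_numeral insertE singletonD)
    then show "e \<in> {e \<in> verts D. odd (card (links e v))}" using e by simp
  next
    fix e assume "e \<in> {e \<in> verts D. odd (card (links e v))}"
    then show "e \<in> incident_edges (\<Gamma>\<lparr>edges := traversed\<rparr>) v"
      using links_empty[of v e] by (fastforce simp: incident_edges_def traversed_def)
  qed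
  \<comment> \<open>Double counting: each edge of \<open>D\<close> labelled \<open>v\<close> is
    counted once for each of its two ends.\<close>
  moreover have "even (\<Sum>e \<in> verts D. card (links e v))"
  proof -
    let ?E = "{x \<in> edges D. snd x = v}"
    have finE: "finite ?E" using finite_edges_D by simp
    have "(\<Sum>e \<in> verts D. card (links e v)) = (\<Sum>e \<in> verts D. \<Sum>x \<in> ?E. of_bool (e \<in> fst x))"
    proof (rule sum.cong)
      fix e
      have "links e v = ?E \<inter> {x. e \<in> fst x}" by (auto simp: links_def)
      then show "card (links e v) = (\<Sum>x \<in> ?E. of_bool (e \<in> fst x))"
        using finE by (simp add: sum_of_bool_eq)
    qed simp
    also have "\<dots> = (\<Sum>x \<in> ?E. \<Sum>e \<in> verts D. of_bool (e \<in> fst x))" by (rule sum.swap)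
    also have "\<dots> = (\<Sum>x \<in> ?E. 2)"
    proof (rule sum.cong)
      fix x assume x: "x \<in> ?E"
      then have "x \<in> edges (line_graph \<Gamma>)" using edges_D by auto
      then have "card (fst x) = 2" by (auto elim!: line_graph_edgeE)
      moreover have "verts D \<inter> {e. e \<in> fst x} = fst x" using fst_D[of x] x by blast
      ultimately show "(\<Sum>e \<in> verts D. of_bool (e \<in> fst x)) = (2::nat)"
        using finite_verts_D by (simp add: sum_of_bool_eq)
    qed simp
    finally show ?thesis by simp
  qed
  ultimately show ?thesis
    using finite_verts_D by (simp add: degree_def even_sum_iff)
qed

lemma traversed_subset: "traversed \<subseteq> edges \<Gamma>"
  using verts_D by (auto simp: traversed_def)

text \<open>The traversed edges form an even set, hence a union of circles, and each of them lies on
  one of these circles.\<close>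

lemma not_isthmus_traversed:
  assumes "e \<in> traversed"
  shows "\<not> isthmus \<Gamma> e"
  using traversed_subset even_traversed assms
proof (induction rule: even_edge_set_induct)
  case (circle C S)
  then show ?case unfolding isthmus_def by blast
qed simp

text \<open>The number of links at \<open>v\<close> is even, not 0 and at most 2, so both joins of
  \<open>e\<close> lie at \<open>v\<close>. They carry the same label, so they differ in the
  neighbours \<open>f\<close> and \<open>g\<close>.\<close>

lemma not_traversedE:
  assumes "e \<in> verts D" "e \<notin> traversed" "x \<in> links e v"
  obtains f g where "links e v = {({e, f}, v), ({e, g}, v)}" "f \<noteq> e" "g \<noteq> e" "f \<noteq> g"
    "{e, f, g} \<subseteq> incident_edges \<Gamma> v \<inter> verts D"
proof -
  have v: "e \<in> edges \<Gamma>" "v \<in> ends \<Gamma> e"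
    using assms(1,3) verts_D links_empty[of v e] by auto
  then obtain u where "ends \<Gamma> e = {u, v}" "u \<noteq> v" by (rule other_end)
  then have "card (links e u) + card (links e v) = 2" using card_links assms(1) by blast
  moreover have "even (card (links e v))" using assms(1,2) by (auto simp: traversed_def)
  moreover have "card (links e v) \<noteq> 0"
    using assms(3) finite_edges_D by (auto simp: links_def)
  ultimately have "card (links e v) = 2" by presburger
  then obtain y z where yz: "links e v = {y, z}" "y \<noteq> z" by (auto simp: card_2_iff)
  obtain f where f: "y = ({e, f}, v)" "f \<noteq> e" "f \<in> verts D" "f \<in> incident_edges \<Gamma> v"
    using linkE[of y e v] yz by blast
  obtain g where g: "z = ({e, g}, v)" "g \<noteq> e" "g \<in> verts D" "g \<in> incident_edges \<Gamma> v"
    using linkE[of z e v] yz by blast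
  show thesis
    by (rule that[of f g]) (use f g yz assms(1) v in \<open>auto simp: incident_edges_def\<close>)
qed

lemma untraversed_link:
  assumes "e \<in> verts D" "e \<notin> traversed"
  obtains v x where "x \<in> links e v"
proof -
  have "e \<in> edges \<Gamma>" using assms(1) verts_D by blast
  then obtain u w where "ends \<Gamma> e = {u, w}" "u \<noteq> w" using card_ends by (metis card_2_iff)
  then have "links e u \<noteq> {} \<or> links e w \<noteq> {}" using card_links[OF assms(1)] by force
  then show thesis using that by blast
qed

text \<open>Both links of \<open>e\<close> at \<open>v\<close> go to the only other edges there,
  \<open>f\<close> and \<open>g\<close>. Now \<open>f\<close> has a link at \<open>v\<close> and is
  untraversed, so it is linked there to \<open>e\<close> and \<open>g\<close>. Thus \<open>g\<close>
  also has two links at \<open>v\<close>. All three edges have spent their degree 2 among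
  themselves, and connectedness of \<open>D\<close> leaves no further vertex.\<close>

lemma verts_triangle:
  assumes hang: "e \<in> verts D" "e \<notin> traversed" "x \<in> links e v"
    and inc: "incident_edges \<Gamma> v = {e, f, g}"
    and f: "f \<noteq> e" "g \<noteq> e" "f \<noteq> g" "f \<notin> traversed"
  shows "verts D = {e, f, g}"
proof -
  have link: "links a v = {({a, b}, v), ({a, c}, v)} \<and> {a, b, c} \<subseteq> verts D"
    if a: "a \<in> verts D" "a \<notin> traversed" "x \<in> links a v" and abc: "{a, b, c} = {e, f, g}"
      "a \<noteq> b" "a \<noteq> c" "b \<noteq> c" for a b c x
  proof -
    obtain b' c' where *: "links a v = {({a, b'}, v), ({a, c'}, v)}" "b' \<noteq> a" "c' \<noteq> a" "b' \<noteq> c'"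
      "{a, b', c'} \<subseteq> incident_edges \<Gamma> v \<inter> verts D"
      using not_traversedE[OF a] .
    then have "b' \<in> {a, b, c}" "c' \<in> {a, b, c}" using inc abc(1) by auto
    then have "b' = b \<and> c' = c \<or> b' = c \<and> c' = b" using * by auto
    then show ?thesis using * by auto
  qed
  have e: "links e v = {({e, f}, v), ({e, g}, v)}" "{e, f, g} \<subseteq> verts D"
    using link[OF hang, of f g] f by auto
  then have "({e, f}, v) \<in> links f v" by (auto simp: links_def)
  then have f': "links f v = {({f, e}, v), ({f, g}, v)}"
    using link[of f _ e g] e(2) f by (auto simp: insert_commute)
  \<comment> \<open>Degree 2 in \<open>D\<close> means that two links at \<open>v\<close> are all
    the joins that \<open>a\<close> has.\<close>
  have incD: "links a v \<supseteq> incident_edges D a" if "a \<in> verts D" "2 \<le> card (links a v)" for a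
  proof -
    have "card (incident_edges D a) = 2"
      using that(1) D by (simp add: circle_of_def circle_graph_def degree_def)
    moreover have "finite (incident_edges D a)" using finite_edges_D by (simp add: incident_edges_def)
    moreover have "links a v \<subseteq> incident_edges D a"
      by (auto simp: links_def incident_edges_def ends_D)
    ultimately show ?thesis using that(2) by (metis card_subset_eq card_mono le_antisym subset_refl)
  qed
  have "{({e, g}, v), ({f, g}, v)} \<subseteq> links g v" using e(1) f' by (auto simp: links_def)
  moreover have "card {({e, g}, v), ({f, g}, v)} = 2" using f by (auto simp: doubleton_eq_iff)
  moreover have "finite (links g v)" using finite_edges_D by (simp add: links_def)
  ultimately have "2 \<le> card (links g v)" by (metis card_mono)
  moreover have "2 \<le> card (links e v)" "2 \<le> card (links f v)"
    using e(1) f' f by (auto simp: doubleton_eq_iff)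
  ultimately have closed: "incident_edges D a \<subseteq> links a v" if "a \<in> {e, f, g}" for a
    using incD[of a] that e(2) by auto
  have "verts D \<subseteq> {e, f, g}"
  proof
    fix h assume "h \<in> verts D"
    with connected_D \<open>e \<in> verts D\<close> show "h \<in> {e, f, g}"
    proof (induction rule: connected_graph_induct)
      case (step a b x)
      then have "x \<in> links a v" using closed[of a] by (auto simp: incident_edges_def)
      then have "fst x \<subseteq> {e, f, g}"
        using inc by (elim linkE) auto
      then show ?case using step(3) ends_D by auto
    qed simp
  qed
  then show ?thesis using e(2) by blast
qed

end

section \<open>Line consistency\<close>

context finite_signed_graph
begin

lemma degree_eq_positive_plus_negative:
  "degree \<Gamma> v = card (positive_edges_at \<Gamma> \<sigma> v) + degree (negative_subgraph \<Gamma> \<sigma>) v"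
proof -
  let ?N = "incident_edges (negative_subgraph \<Gamma> \<sigma>) v"
  have "incident_edges \<Gamma> v = positive_edges_at \<Gamma> \<sigma> v \<union> ?N"
    using sign_values by (auto simp: positive_edges_at_def incident_edges_def negative_subgraph_def)
  moreover have "positive_edges_at \<Gamma> \<sigma> v \<inter> ?N = {}"
    by (auto simp: positive_edges_at_def incident_edges_def negative_subgraph_def)
  ultimately show ?thesis
    unfolding degree_def by (metis card_Un_disjoint finite_Un finite_incident_edges)
qed

lemma not_totally_positive_iff:
  "\<not> totally_positive \<Gamma> \<sigma> v \<longleftrightarrow> (\<exists>f \<in> edges \<Gamma>. \<sigma> f = -1 \<and> v \<in> ends \<Gamma> f)"
  using sign_values by (force simp: totally_positive_def incident_edges_def)

lemma negative_degree_positive: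
  assumes "f \<in> edges \<Gamma>" "\<sigma> f = -1" "v \<in> ends \<Gamma> f"
  shows "degree (negative_subgraph \<Gamma> \<sigma>) v > 0"
proof -
  have "f \<in> incident_edges (negative_subgraph \<Gamma> \<sigma>) v"
    using assms by (simp add: incident_edges_def negative_subgraph_def)
  moreover have "finite (incident_edges (negative_subgraph \<Gamma> \<sigma>) v)"
    using finite_edges by (simp add: incident_edges_def negative_subgraph_def)
  ultimately show ?thesis unfolding degree_def by (metis card_gt_0_iff empty_iff)
qed

lemma disjoint_union_negative_subgraph_iff:
  "disjoint_union_of_paths_and_circles (negative_subgraph \<Gamma> \<sigma>) \<longleftrightarrow>
     (\<forall>v. degree (negative_subgraph \<Gamma> \<sigma>) v \<le> 2)"
proof -
  have "finite_loopless_multigraph (negative_subgraph \<Gamma> \<sigma>)"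
    unfolding negative_subgraph_def by (rule finite_loopless_multigraph_restrict) blast
  then show ?thesis by (rule finite_loopless_multigraph.disjoint_union_of_paths_and_circles_iff)
qed

text \<open>The sign product is multiplicative over the edge-disjoint circles that make up an even
  set.\<close>

lemma balanced_prod_even:
  assumes "balanced \<Gamma> \<sigma>" "T \<subseteq> edges \<Gamma>" "\<And>v. even (degree (\<Gamma>\<lparr>edges := T\<rparr>) v)"
  shows "prod \<sigma> T = 1"
  using assms(2,3)
proof (induction rule: even_edge_set_induct)
  case (circle C S)
  have "edges C \<subseteq> edges \<Gamma>" using circle(1) by (simp add: circle_of_def subgraph_def)
  then have "finite (edges C)" "finite S" using circle(2) finite_edges finite_subset by blast+
  then have "prod \<sigma> (edges C \<union> S) = prod \<sigma> (edges C) * prod \<sigma> S"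
    using circle(3) by (intro prod.union_disjoint)
  then show ?case using circle(1,4) assms(1) by (simp add: balanced_def)
qed simp

text \<open>The part of condition (i) other than balance. It is split off because conditions (ii)
  and (iii) are each compared with it while balance is carried along.\<close>

definition vertex_condition :: bool where
  "vertex_condition \<longleftrightarrow> (\<forall>v \<in> verts \<Gamma>. degree \<Gamma> v > 3 \<longrightarrow> totally_positive \<Gamma> \<sigma> v)
     \<and> (\<forall>v \<in> verts \<Gamma>. degree \<Gamma> v = 3 \<longrightarrow>
          totally_positive \<Gamma> \<sigma> v \<or> (\<exists>e. positive_edges_at \<Gamma> \<sigma> v = {e} \<and> isthmus \<Gamma> e))"

text \<open>Total positivity fails exactly at the endpoints of negative edges, so the condition is
  used, and in \<open>vertex_conditionI\<close> established, only at such an endpoint.\<close>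

lemma vertex_conditionD:
  assumes "vertex_condition" "f \<in> edges \<Gamma>" "\<sigma> f = -1" "v \<in> ends \<Gamma> f"
  obtains "degree \<Gamma> v \<le> 2"
  | e where "degree \<Gamma> v = 3" "positive_edges_at \<Gamma> \<sigma> v = {e}" "isthmus \<Gamma> e"
proof -
  have "v \<in> verts \<Gamma>" using assms(2,4) ends_in_verts by blast
  moreover have "\<not> totally_positive \<Gamma> \<sigma> v" using assms(2-4) not_totally_positive_iff by blast
  ultimately have "\<not> degree \<Gamma> v > 3"
    "degree \<Gamma> v = 3 \<Longrightarrow> \<exists>e. positive_edges_at \<Gamma> \<sigma> v = {e} \<and> isthmus \<Gamma> e"
    using assms(1) unfolding vertex_condition_def by blast+
  then show thesis using that by (metis Suc_1 le_SucE linorder_not_less numeral_3_eq_3 numeral_2_eq_2)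
qed

lemma vertex_conditionI:
  assumes "\<And>f v. \<lbrakk>f \<in> edges \<Gamma>; \<sigma> f = -1; v \<in> ends \<Gamma> f; degree \<Gamma> v > 2\<rbrakk> \<Longrightarrow>
    degree \<Gamma> v = 3 \<and> (\<exists>e. positive_edges_at \<Gamma> \<sigma> v = {e} \<and> isthmus \<Gamma> e)"
  shows "vertex_condition"
proof -
  have *: "totally_positive \<Gamma> \<sigma> v \<or>
      degree \<Gamma> v = 3 \<and> (\<exists>e. positive_edges_at \<Gamma> \<sigma> v = {e} \<and> isthmus \<Gamma> e)"
    if "degree \<Gamma> v > 2" for v
    using assms[of _ v] that not_totally_positive_iff[of v] by blast
  show ?thesis
    unfolding vertex_condition_def
  proof (intro conjI ballI impI)
    show "totally_positive \<Gamma> \<sigma> v" if "degree \<Gamma> v > 3" for v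
      using *[of v] that by simp
    show "totally_positive \<Gamma> \<sigma> v \<or> (\<exists>e. positive_edges_at \<Gamma> \<sigma> v = {e} \<and> isthmus \<Gamma> e)"
      if "degree \<Gamma> v = 3" for v
      using *[of v] that by simp
  qed
qed

section \<open>Necessity of balance and the vertex condition\<close>

lemma line_consistent_triangle:
  assumes "line_consistent \<Gamma> \<sigma>" "{e, f, g} \<subseteq> incident_edges \<Gamma> v" "e \<noteq> f" "f \<noteq> g" "e \<noteq> g"
  shows "\<sigma> e * \<sigma> f * \<sigma> g = 1"
proof -
  obtain D where D: "circle_of D (line_graph \<Gamma>)" "verts D = {e, f, g}"
    using assms(2-5) by (rule line_graph_triangle)
  have "(\<Prod>x \<in> verts D. \<sigma> x) = 1" using D(1) assms(1) by (simp add: line_consistent_def consistent_def)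
  then show ?thesis unfolding D(2) using assms(3-5) by (simp add: mult.assoc)
qed

lemma line_consistent_imp_balanced:
  assumes "line_consistent \<Gamma> \<sigma>"
  shows "balanced \<Gamma> \<sigma>"
  unfolding balanced_def
proof (intro allI impI)
  fix C assume "circle_of C \<Gamma>"
  then have "(\<Prod>e \<in> verts (line_graph C). \<sigma> e) = 1"
    using assms circle_of_line_graph unfolding line_consistent_def consistent_def by blast
  then show "(\<Prod>e \<in> edges C. \<sigma> e) = 1" by simp
qed

lemma line_consistent_imp_vertex_condition:
  assumes lc: "line_consistent \<Gamma> \<sigma>"
  shows "vertex_condition"
proof (rule vertex_conditionI)
  fix f v assume f: "f \<in> edges \<Gamma>" "\<sigma> f = -1" "v \<in> ends \<Gamma> f" and deg: "degree \<Gamma> v > 2"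
  let ?I = "incident_edges \<Gamma> v"
  have fI: "f \<in> ?I" using f by (simp add: incident_edges_def)
  have sgn: "\<sigma> e = 1 \<or> \<sigma> e = -1" if "e \<in> ?I" for e
    using sign_values that by (simp add: incident_edges_def)
  \<comment> \<open>The triangle on \<open>f\<close>, \<open>a\<close>, \<open>b\<close> is positive
    while \<open>f\<close> is negative, so exactly one of \<open>a\<close>, \<open>b\<close> is
    negative.\<close>
  have opp: "\<sigma> b = - \<sigma> a" if "{a, b} \<subseteq> ?I" "a \<noteq> f" "b \<noteq> f" "a \<noteq> b" for a b
    using line_consistent_triangle[OF lc, of f a b v] fI f(2) that sgn[of a] sgn[of b] by auto
  have deg3: "degree \<Gamma> v = 3"
  proof (rule ccontr)
    assume "degree \<Gamma> v \<noteq> 3"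
    then have "3 \<le> card (?I - {f})" using deg fI by (simp add: degree_def)
    then obtain S where "S \<subseteq> ?I - {f}" "card S = 3" by (meson obtain_subset_with_card_n)
    then obtain a b c where "{a, b, c} \<subseteq> ?I - {f}" "a \<noteq> b" "b \<noteq> c" "a \<noteq> c"
      by (auto simp: card_3_iff)
    \<comment> \<open>Three further edges at \<open>v\<close> would have pairwise opposite signs,
      which two sign values do not allow.\<close>
    then have "\<sigma> b = - \<sigma> a" "\<sigma> c = - \<sigma> a" "\<sigma> c = - \<sigma> b" "\<sigma> a = 1 \<or> \<sigma> a = -1"
      using opp[of a b] opp[of a c] opp[of b c] sgn[of a] by auto
    then show False by auto
  qed
  then have "card (?I - {f}) = 2" using fI by (simp add: degree_def)
  then obtain a b where ab: "?I - {f} = {a, b}" "a \<noteq> b" by (auto simp: card_2_iff)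
  then have "\<sigma> b = - \<sigma> a" "\<sigma> a = 1 \<or> \<sigma> a = -1" using opp[of a b] sgn[of a] by auto
  then obtain e g where eg: "?I = {e, f, g}" "\<sigma> e = 1" "\<sigma> g = -1"
    using ab(1) fI by (metis add.inverse_inverse insert_Diff insert_commute)
  have "positive_edges_at \<Gamma> \<sigma> v = {e}"
    using eg f(2) by (auto simp: positive_edges_at_def)
  moreover have "isthmus \<Gamma> e"
    unfolding isthmus_def
  proof (intro conjI notI)
    show "e \<in> edges \<Gamma>" using eg(1) by (auto simp: incident_edges_def)
    assume "\<exists>C. circle_of C \<Gamma> \<and> e \<in> edges C"
    then obtain C where C: "circle_of C \<Gamma>" "e \<in> edges C" by blast
    have "v \<in> ends \<Gamma> e" using eg(1) by (auto simp: incident_edges_def)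
    then obtain h where h: "incident_edges C v = {e, h}" "h \<noteq> e"
      using C by (elim circle_of_other_edge)
    have sub: "edges C \<subseteq> edges \<Gamma>" "ends C = ends \<Gamma>"
      using C(1) by (simp_all add: circle_of_def subgraph_def)
    then have "h \<in> ?I" using h by (auto simp: incident_edges_def)
    then have "h = f \<or> h = g" using h(2) eg(1) by auto
    moreover have "f \<noteq> g" using deg3 eg(1) by (auto simp: degree_def card_insert_if split: if_splits)
    \<comment> \<open>At \<open>v\<close> the circle uses \<open>e\<close> and just one of the
      negative edges \<open>f\<close>, \<open>g\<close>. The other one is \<open>k\<close>, and the
      detour through it multiplies the sign of the balanced circle by -1.\<close>
    ultimately obtain k where k: "k \<in> ?I" "\<sigma> k = -1" "k \<noteq> h" "k \<noteq> e"
      using eg f(2) by (metis insertCI one_neq_neg_one)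
    have "k \<notin> edges C"
    proof
      assume "k \<in> edges C"
      then have "k \<in> incident_edges C v" using k(1) sub(2) by (simp add: incident_edges_def)
      then show False using h(1) k(3,4) by auto
    qed
    then obtain D where D: "circle_of D (line_graph \<Gamma>)" "verts D = insert k (edges C)"
      using line_graph_circle_detour[OF C(1), of e h v k] h k(1) by auto
    have "prod \<sigma> (insert k (edges C)) = 1"
      using D lc unfolding line_consistent_def consistent_def by metis
    moreover have "finite (edges C)" using sub(1) finite_edges finite_subset by blast
    moreover have "prod \<sigma> (edges C) = 1"
      using C(1) line_consistent_imp_balanced[OF lc] by (simp add: balanced_def)
    ultimately show False using \<open>k \<notin> edges C\<close> k(2) by simp
  qed
  ultimately show "degree \<Gamma> v = 3 \<and> (\<exists>e. positive_edges_at \<Gamma> \<sigma> v = {e} \<and> isthmus \<Gamma> e)"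
    using deg3 by blast
qed

section \<open>Sufficiency of balance and the vertex condition\<close>

lemma line_consistentI:
  assumes bal: "balanced \<Gamma> \<sigma>" and vc: "vertex_condition"
  shows "line_consistent \<Gamma> \<sigma>"
  unfolding line_consistent_def consistent_def
proof (intro allI impI)
  fix D assume "circle_of D (line_graph \<Gamma>)"
  then interpret line_graph_circle \<Gamma> D by unfold_locales
  show "(\<Prod>e \<in> verts D. \<sigma> e) = 1"
  proof (cases "\<exists>e \<in> verts D - traversed. \<sigma> e = -1")
    case False
    \<comment> \<open>All untraversed edges are positive here, so the product reduces to the even
      set \<open>traversed\<close>.\<close>
    then have "\<forall>e \<in> verts D - traversed. \<sigma> e = 1" using sign_values verts_D by blast
    moreover have "traversed \<subseteq> verts D" by (auto simp: traversed_def)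
    ultimately have "prod \<sigma> (verts D) = prod \<sigma> traversed"
      using finite_verts_D by (intro prod.mono_neutral_right)
    also have "\<dots> = 1" using bal traversed_subset even_traversed by (rule balanced_prod_even)
    finally show ?thesis .
  next
    case True
    then obtain e where e: "e \<in> verts D" "e \<notin> traversed" "\<sigma> e = -1" by blast
    then obtain v x where x: "x \<in> links e v" using untraversed_link by blast
    obtain f g where "links e v = {({e, f}, v), ({e, g}, v)}"
      and fg: "f \<noteq> e" "g \<noteq> e" "f \<noteq> g" "{e, f, g} \<subseteq> incident_edges \<Gamma> v \<inter> verts D"
      using not_traversedE[OF e(1,2) x] .
    then have "card {e, f, g} = 3" by auto
    then have deg: "degree \<Gamma> v \<ge> 3"
      using fg(4) unfolding degree_def by (metis card_mono finite_incident_edges le_inf_iff)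
    have ev: "e \<in> edges \<Gamma>" "v \<in> ends \<Gamma> e" using fg(4) by (auto simp: incident_edges_def)
    \<comment> \<open>The edge \<open>e\<close> turns back at \<open>v\<close> and has two further
      edges there, which excludes the alternative of degree at most 2.\<close>
    obtain p where p: "degree \<Gamma> v = 3" "positive_edges_at \<Gamma> \<sigma> v = {p}" "isthmus \<Gamma> p"
      by (rule vertex_conditionD[OF vc ev(1) e(3) ev(2)]) (use deg in linarith, use that in blast)
    have inc: "incident_edges \<Gamma> v = {e, f, g}"
      using p(1) fg(4) \<open>card {e, f, g} = 3\<close> unfolding degree_def
      by (metis card_subset_eq finite_incident_edges le_inf_iff)
    have pI: "p \<in> incident_edges \<Gamma> v" "\<sigma> p = 1" using p(2) by (auto simp: positive_edges_at_def)
    then have "p = f \<or> p = g" using inc e(3) by auto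
    then obtain q where q: "incident_edges \<Gamma> v = {e, p, q}" "p \<noteq> e" "q \<noteq> e" "p \<noteq> q"
      using inc fg(1-3) by (metis insert_commute)
    \<comment> \<open>Being an isthmus, \<open>p\<close> must turn back as well. This closes
      \<open>D\<close> to the triangle at \<open>v\<close>, whose only positive edge is
      \<open>p\<close>, so its sign is that of two negative edges.\<close>
    have "p \<notin> traversed" using p(3) not_isthmus_traversed by blast
    then have V: "verts D = {e, p, q}" using verts_triangle[OF e(1,2) x q(1)] q by blast
    have "q \<in> incident_edges \<Gamma> v" "q \<notin> positive_edges_at \<Gamma> \<sigma> v"
      using q(1,4) p(2) by simp_all
    then have "\<sigma> q = -1"
      using sign_values[of q] by (simp add: positive_edges_at_def incident_edges_def)
    then show ?thesis using V q pI(2) e(3) by simp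
  qed
qed

lemma line_consistent_iff: "line_consistent \<Gamma> \<sigma> \<longleftrightarrow> balanced \<Gamma> \<sigma> \<and> vertex_condition"
  using line_consistentI line_consistent_imp_balanced line_consistent_imp_vertex_condition by blast

section \<open>Comparison with conditions (ii) and (iii)\<close>

lemma vertex_condition_iff_negative_subgraph:
  "vertex_condition \<longleftrightarrow>
     disjoint_union_of_paths_and_circles (negative_subgraph \<Gamma> \<sigma>)
   \<and> (\<forall>f \<in> edges \<Gamma>. \<sigma> f = -1 \<longrightarrow> (\<forall>v \<in> ends \<Gamma> f.
        card (positive_edges_at \<Gamma> \<sigma> v) \<le> 1
      \<and> (degree (negative_subgraph \<Gamma> \<sigma>) v = 2 \<longrightarrow>
           (\<forall>e \<in> positive_edges_at \<Gamma> \<sigma> v. isthmus \<Gamma> e))))"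
    (is "_ \<longleftrightarrow> ?paths \<and> ?ends")
proof
  \<comment> \<open>Both directions count edges at an endpoint of a negative edge, where the degree
    is \<open>?n v\<close> plus the number of positive edges. Degree 3 with one positive edge means
    \<open>?n v = 2\<close>.\<close>
  let ?n = "degree (negative_subgraph \<Gamma> \<sigma>)" and ?P = "positive_edges_at \<Gamma> \<sigma>"
  have finP: "finite (?P v)" for v by (simp add: positive_edges_at_def)
  {
    assume vc: "vertex_condition"
    have *: "?n v \<le> 2 \<and> card (?P v) \<le> 1 \<and> (?n v = 2 \<longrightarrow> (\<forall>e \<in> ?P v. isthmus \<Gamma> e))"
      if f: "f \<in> edges \<Gamma>" "\<sigma> f = -1" "v \<in> ends \<Gamma> f" for f v
      using vertex_conditionD[OF vc f]
    proof cases
      case 1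
      have "card (?P v) + ?n v \<le> 2" "?n v > 0"
        using 1 degree_eq_positive_plus_negative[of v] negative_degree_positive[OF f] by simp_all
      \<comment> \<open>With degree at most 2, two negative edges leave no positive one, and the
        isthmus clause is vacuous.\<close>
      moreover from this(1) have "?P v = {}" if "?n v = 2" using that finP[of v] by simp
      ultimately show ?thesis by auto
    next
      case (2 e)
      then show ?thesis using degree_eq_positive_plus_negative[of v] by simp
    qed
    have "?n v \<le> 2" for v
    proof (cases "totally_positive \<Gamma> \<sigma> v")
      case True
      then have "incident_edges (negative_subgraph \<Gamma> \<sigma>) v = {}"
        using not_totally_positive_iff[of v] by (auto simp: incident_edges_def negative_subgraph_def)
      then show ?thesis by (simp add: degree_def)
    next
      case False
      then show ?thesis using not_totally_positive_iff[of v] * by blast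
    qed
    then show "?paths \<and> ?ends" using * disjoint_union_negative_subgraph_iff by blast
  }
  assume h: "?paths \<and> ?ends"
  show "vertex_condition"
  proof (rule vertex_conditionI)
    fix f v assume f: "f \<in> edges \<Gamma>" "\<sigma> f = -1" "v \<in> ends \<Gamma> f" and "degree \<Gamma> v > 2"
    moreover have "?n v \<le> 2" using h disjoint_union_negative_subgraph_iff by blast
    moreover have "card (?P v) \<le> 1" and isth: "?n v = 2 \<Longrightarrow> \<forall>e \<in> ?P v. isthmus \<Gamma> e"
      using h f by blast+
    \<comment> \<open>A degree above 2 with at most two negative edges and at most one positive edge
      attains both bounds.\<close>
    ultimately have n: "?n v = 2" "card (?P v) = 1" "degree \<Gamma> v = 3"
      using degree_eq_positive_plus_negative[of v] by linarith+
    then obtain e where "?P v = {e}" by (metis card_1_singletonE)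
    then show "degree \<Gamma> v = 3 \<and> (\<exists>e. ?P v = {e} \<and> isthmus \<Gamma> e)" using isth n by simp
  qed
qed

text \<open>No circle contains an isthmus, so the deletion destroys none; this is why balance may be
  tested before or after it.\<close>

lemma circle_of_delete_positive_isthmi:
  "circle_of C (delete_positive_isthmi \<Gamma> \<sigma>) \<longleftrightarrow> circle_of C \<Gamma>"
proof
  assume C: "circle_of C \<Gamma>"
  then have "\<not> isthmus \<Gamma> e" if "e \<in> edges C" for e using that by (auto simp: isthmus_def)
  then show "circle_of C (delete_positive_isthmi \<Gamma> \<sigma>)"
    using C by (simp add: circle_of_def subgraph_def delete_positive_isthmi_def subset_iff)
next
  show "circle_of C \<Gamma>" if "circle_of C (delete_positive_isthmi \<Gamma> \<sigma>)"
    by (rule circle_of_edges_update_subset[OF _ that[unfolded delete_positive_isthmi_def]]) blast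
qed

lemma balanced_delete_positive_isthmi:
  "balanced (delete_positive_isthmi \<Gamma> \<sigma>) \<sigma> \<longleftrightarrow> balanced \<Gamma> \<sigma>"
  by (simp add: balanced_def circle_of_delete_positive_isthmi)

text \<open>Consider an endpoint of a negative edge that has degree 3 and exactly one positive edge.
  Its degree drops to 2 precisely when that positive edge is deleted, that is, when it is an
  isthmus.\<close>

lemma vertex_condition_iff_delete_positive_isthmi:
  "vertex_condition \<longleftrightarrow>
     (\<forall>v \<in> verts \<Gamma>. degree \<Gamma> v > 3 \<longrightarrow> totally_positive \<Gamma> \<sigma> v)
   \<and> (\<forall>v \<in> verts \<Gamma>. degree \<Gamma> v = 3 \<longrightarrow>
        totally_positive \<Gamma> \<sigma> v \<or> card (positive_edges_at \<Gamma> \<sigma> v) = 1)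
   \<and> (\<forall>f \<in> edges (delete_positive_isthmi \<Gamma> \<sigma>). \<sigma> f = -1 \<longrightarrow>
        (\<forall>v \<in> ends \<Gamma> f. degree (delete_positive_isthmi \<Gamma> \<sigma>) v \<le> 2))"
    (is "_ \<longleftrightarrow> ?large \<and> ?three \<and> ?deleted")
proof
  let ?G = "delete_positive_isthmi \<Gamma> \<sigma>"
  have sub: "incident_edges ?G v \<subseteq> incident_edges \<Gamma> v" for v
    by (auto simp: incident_edges_def delete_positive_isthmi_def)
  {
    assume vc: "vertex_condition"
    then have "?large \<and> ?three" by (fastforce simp: vertex_condition_def)
    moreover have "degree ?G v \<le> 2" if "f \<in> edges ?G" "\<sigma> f = -1" "v \<in> ends \<Gamma> f" for f v
    proof -
      have f: "f \<in> edges \<Gamma>" using that(1) by (simp add: delete_positive_isthmi_def)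
      show ?thesis
        using vertex_conditionD[OF vc f that(2,3)]
      proof cases
        case 1
        then show ?thesis
          using card_mono[OF finite_incident_edges sub] by (auto simp: degree_def intro: le_trans)
      next
        case (2 e)
        then have e: "e \<in> incident_edges \<Gamma> v" "\<sigma> e = 1" by (auto simp: positive_edges_at_def)
        then have "incident_edges ?G v \<subseteq> incident_edges \<Gamma> v - {e}"
          using 2(3) by (auto simp: incident_edges_def delete_positive_isthmi_def)
        then have "degree ?G v \<le> card (incident_edges \<Gamma> v - {e})"
          unfolding degree_def by (intro card_mono) simp_all
        also have "\<dots> = 2" using 2(1) e(1) by (simp add: degree_def)
        finally show ?thesis .
      qed
    qed
    ultimately show "?large \<and> ?three \<and> ?deleted" by blast
  }
  assume h: "?large \<and> ?three \<and> ?deleted"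
  show "vertex_condition"
  proof (rule vertex_conditionI)
    fix f v assume f: "f \<in> edges \<Gamma>" "\<sigma> f = -1" "v \<in> ends \<Gamma> f" and deg: "degree \<Gamma> v > 2"
    have "v \<in> verts \<Gamma>" using f ends_in_verts by blast
    moreover have "\<not> totally_positive \<Gamma> \<sigma> v" using f not_totally_positive_iff by blast
    ultimately have deg3: "degree \<Gamma> v = 3" and "card (positive_edges_at \<Gamma> \<sigma> v) = 1"
      using h deg by (metis linorder_neqE_nat not_less_eq numeral_3_eq_3 numeral_2_eq_2)+
    then obtain e where e: "positive_edges_at \<Gamma> \<sigma> v = {e}" by (metis card_1_singletonE)
    have "f \<in> edges ?G" using f by (simp add: delete_positive_isthmi_def)
    then have "degree ?G v \<le> 2" using h f by blast
    \<comment> \<open>The drop from degree 3 shows that some edge at \<open>v\<close> was deleted.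
      It is a positive isthmus, hence the unique positive edge \<open>e\<close>.\<close>
    then have "incident_edges ?G v \<noteq> incident_edges \<Gamma> v" using deg3 by (auto simp: degree_def)
    then obtain d where "d \<in> incident_edges \<Gamma> v" "\<sigma> d = 1" "isthmus \<Gamma> d"
      using sub[of v] by (auto simp: incident_edges_def delete_positive_isthmi_def)
    moreover from this(1,2) have "d = e" using e by (auto simp: positive_edges_at_def)
    ultimately show "degree \<Gamma> v = 3 \<and> (\<exists>e. positive_edges_at \<Gamma> \<sigma> v = {e} \<and> isthmus \<Gamma> e)"
      using deg3 e by blast
  qed
qed

end

theorem theorem2:
  fixes \<Gamma> :: "('v, 'e) mgraph" and \<sigma> :: "'e \<Rightarrow> int"
  assumes "finite_signed_graph \<Gamma> \<sigma>"
  shows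
    "(line_consistent \<Gamma> \<sigma> \<longleftrightarrow>
        balanced \<Gamma> \<sigma>
      \<and> (\<forall>v \<in> verts \<Gamma>. degree \<Gamma> v > 3 \<longrightarrow> totally_positive \<Gamma> \<sigma> v)
      \<and> (\<forall>v \<in> verts \<Gamma>. degree \<Gamma> v = 3 \<longrightarrow>
           totally_positive \<Gamma> \<sigma> v \<or> (\<exists>e. positive_edges_at \<Gamma> \<sigma> v = {e} \<and> isthmus \<Gamma> e)))
   \<and> (line_consistent \<Gamma> \<sigma> \<longleftrightarrow>
        balanced \<Gamma> \<sigma>
      \<and> disjoint_union_of_paths_and_circles (negative_subgraph \<Gamma> \<sigma>)
      \<and> (\<forall>f \<in> edges \<Gamma>. \<sigma> f = -1 \<longrightarrow> (\<forall>v \<in> ends \<Gamma> f.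
           card (positive_edges_at \<Gamma> \<sigma> v) \<le> 1
         \<and> (degree (negative_subgraph \<Gamma> \<sigma>) v = 2 \<longrightarrow>
              (\<forall>e \<in> positive_edges_at \<Gamma> \<sigma> v. isthmus \<Gamma> e)))))
   \<and> (line_consistent \<Gamma> \<sigma> \<longleftrightarrow>
        (\<forall>v \<in> verts \<Gamma>. degree \<Gamma> v > 3 \<longrightarrow> totally_positive \<Gamma> \<sigma> v)
      \<and> (\<forall>v \<in> verts \<Gamma>. degree \<Gamma> v = 3 \<longrightarrow>
           totally_positive \<Gamma> \<sigma> v \<or> card (positive_edges_at \<Gamma> \<sigma> v) = 1)
      \<and> balanced (delete_positive_isthmi \<Gamma> \<sigma>) \<sigma>
      \<and> (\<forall>f \<in> edges (delete_positive_isthmi \<Gamma> \<sigma>). \<sigma> f = -1 \<longrightarrow>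
           (\<forall>v \<in> ends \<Gamma> f. degree (delete_positive_isthmi \<Gamma> \<sigma>) v \<le> 2)))"
proof -
  interpret finite_signed_graph \<Gamma> \<sigma> by (rule assms)
  show ?thesis
  proof (intro conjI, goal_cases)
    case 1
    show ?case unfolding line_consistent_iff vertex_condition_def by (rule refl)
  next
    case 2
    show ?case unfolding line_consistent_iff vertex_condition_iff_negative_subgraph by (rule refl)
  next
    case 3
    show ?case
      \<comment> \<open>In condition (iii) balance stands between the vertex clauses, so the
        conjuncts have to be reordered.\<close>
      unfolding line_consistent_iff vertex_condition_iff_delete_positive_isthmi
        balanced_delete_positive_isthmi
      by (simp only: conj_ac)
  qed
qed

end
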